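(* Let $\gamma>1$ and let $\mu$ be a positive Borel measure on $\mathbb{B}_n$. Then: (1) for some (or all) $R>0$, $$\sup_{a\in\mathbb{B}_n}\frac{\mu(D(a,R))}{(1-|a|^2)^{n\gamma}}<\infty$$ if and only if $$\sup_{\zeta\in\mathbb{S}_n,\ r\in(0,1)}\frac{\mu(Q_r(\zeta))}{r^{n\gamma}}<\infty;$$ (2) for some (or all) $R>0$, $$\lim_{|a|\to1}\frac{\mu(D(a,R))}{(1-|a|^2)^{n\gamma}}=0$$ if and only if $$\lim_{r\to0}\frac{\mu(Q_r(\zeta))}{r^{n\gamma}}=0\quad\text{uniformly for }\zeta\in\mathbb{S}_n.$$
   Context: $\mathbb{B}_n$ is the open unit ball of $\mathbb{C}^n$ ($n\ge1$), $\mathbb{S}_n=\partial\mathbb{B}_n$, and $\langle z,w\rangle=\sum_j z_j\overline{w_j}$. For $\zeta\in\mathbb{S}_n$ and $r\in(0,1)$ the Carleson cube is $Q_r(\zeta)=\{z\in\mathbb{B}_n:|1-\langle z,\zeta\rangle|<r\}$. For $z\in\mathbb{B}_n$, $\varphi_z$ is the involutive automorphism of $\mathbb{B}_n$ interchanging $0$ and $z$. The Bergman metric is $\beta(z,w)=\frac12\log\frac{1+|\varphi_z(w)|}{1-|\varphi_z(w)|}$, and for $R>0$ the Bergman metric ball is $D(z,R)=\{w\in\mathbb{B}_n:\beta(z,w)<R\}$. "For some (or all) $R>0$" means that the equivalence is asserted both when the Bergman-ball condition is required for some $R>0$ and when it is required for all $R>0$.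
   Formalization: Part (1) is proved under the additional assumption that μ({0}) is finite; it fails for an infinite point mass at 0, which lies in no Q_r(ζ) with r<1. Part (2) needs no such assumption. *)

theory Defs
  imports "HOL-Analysis.Analysis"
begin

text \<open>
  The space of \<open>n\<close> complex variables is \<^typ>\<open>complex ^ 'n\<close> with \<open>n = CARD('n)\<close>; its library norm
  is the Euclidean one, so \<^term>\<open>ball 0 1\<close> and \<^term>\<open>sphere 0 1\<close> are the usual unit ball and
  unit sphere.  The library inner product on this type is real-valued, hence a separate
  definition of the Hermitian one.
\<close>

definition herm :: "complex ^ 'n \<Rightarrow> complex ^ 'n \<Rightarrow> complex"
  where "herm z w = (\<Sum>j\<in>UNIV. z $ j * cnj (w $ j))"

definition carleson_cube :: "complex ^ 'n \<Rightarrow> real \<Rightarrow> (complex ^ 'n) set"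
  where "carleson_cube \<zeta> r = {z \<in> ball 0 1. cmod (1 - herm z \<zeta>) < r}"

text \<open>
  Being an involutive automorphism of the ball that interchanges \<open>0\<close> and \<open>z\<close> determines
  \<open>\<phi>\<^sub>z\<close> only up to a unitary involution fixing \<open>z\<close> (which does not affect \<open>|\<phi>\<^sub>z(w)|\<close>), so it is
  given here by the standard formula
  \<open>\<phi>\<^sub>z(w) = (z - P\<^sub>z w - (1 - |z|\<^sup>2)\<^sup>1\<^sup>/\<^sup>2 (w - P\<^sub>z w)) / (1 - \<langle>w,z\<rangle>)\<close>, where \<open>P\<^sub>z\<close> is the orthogonal
  projection onto the complex line through \<open>z\<close>.  As \<open>x / 0 = 0\<close>, the formula for \<open>P\<^sub>z\<close> yields
  \<open>P\<^sub>0 = 0\<close> and \<open>\<phi>\<^sub>0(w) = -w\<close>, as it should.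
\<close>

definition line_proj :: "complex ^ 'n \<Rightarrow> complex ^ 'n \<Rightarrow> complex ^ 'n"
  where "line_proj z w = (herm w z / herm z z) *s z"

definition ball_involution :: "complex ^ 'n \<Rightarrow> complex ^ 'n \<Rightarrow> complex ^ 'n"
  where "ball_involution z w =
    inverse (1 - herm w z) *s
      (z - line_proj z w - sqrt (1 - (norm z)\<^sup>2) *\<^sub>R (w - line_proj z w))"

definition bergman_metric :: "complex ^ 'n \<Rightarrow> complex ^ 'n \<Rightarrow> real"
  where "bergman_metric z w =
    1/2 * ln ((1 + norm (ball_involution z w)) / (1 - norm (ball_involution z w)))"

definition bergman_ball :: "complex ^ 'n \<Rightarrow> real \<Rightarrow> (complex ^ 'n) set"
  where "bergman_ball z R = {w \<in> ball 0 1. bergman_metric z w < R}"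

definition bergman_ratio ::
    "real \<Rightarrow> (complex ^ 'n) measure \<Rightarrow> real \<Rightarrow> complex ^ 'n \<Rightarrow> ennreal"
  where "bergman_ratio \<gamma> \<mu> R a =
    emeasure \<mu> (bergman_ball a R) / ennreal ((1 - (norm a)\<^sup>2) powr (real CARD('n) * \<gamma>))"

definition carleson_ratio ::
    "real \<Rightarrow> (complex ^ 'n) measure \<Rightarrow> complex ^ 'n \<Rightarrow> real \<Rightarrow> ennreal"
  where "carleson_ratio \<gamma> \<mu> \<zeta> r =
    emeasure \<mu> (carleson_cube \<zeta> r) / ennreal (r powr (real CARD('n) * \<gamma>))"

text \<open>
  Measures may be infinite.  The Bergman ball about \<open>0\<close> contains \<open>0\<close>, but no Carleson cube with
  \<open>r < 1\<close> does; hence for an infinite point mass at \<open>0\<close> the two boundedness conditions below are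
  not equivalent.  Any of the usual finiteness conventions for Borel measures (finite, or finite on
  compact subsets of the ball) implies the condition \<^prop>\<open>emeasure \<mu> {0} < \<infinity>\<close> that excludes this.
\<close>

definition bergman_bounded :: "real \<Rightarrow> (complex ^ 'n) measure \<Rightarrow> real \<Rightarrow> bool"
  where "bergman_bounded \<gamma> \<mu> R \<longleftrightarrow> (SUP a\<in>ball 0 1. bergman_ratio \<gamma> \<mu> R a) < \<infinity>"

definition carleson_bounded :: "real \<Rightarrow> (complex ^ 'n) measure \<Rightarrow> bool"
  where "carleson_bounded \<gamma> \<mu> \<longleftrightarrow>
    (SUP (\<zeta>, r)\<in>sphere 0 1 \<times> {0<..<1}. carleson_ratio \<gamma> \<mu> \<zeta> r) < \<infinity>"

text \<open>
  The filter of \<open>|a| \<rightarrow> 1\<close> through points of the open ball is \<^term>\<open>filtercomap norm (at_left 1)\<close>.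
  The uniform limit is spelled out because \<^typ>\<open>ennreal\<close> is not an instance of the metric class
  that the library's uniform limits require.
\<close>

definition bergman_vanishing :: "real \<Rightarrow> (complex ^ 'n) measure \<Rightarrow> real \<Rightarrow> bool"
  where "bergman_vanishing \<gamma> \<mu> R \<longleftrightarrow>
    (bergman_ratio \<gamma> \<mu> R \<longlongrightarrow> 0) (filtercomap norm (at_left 1))"

definition carleson_vanishing :: "real \<Rightarrow> (complex ^ 'n) measure \<Rightarrow> bool"
  where "carleson_vanishing \<gamma> \<mu> \<longleftrightarrow>
    (\<forall>\<epsilon>>0::real. \<forall>\<^sub>F r in at_right 0. \<forall>\<zeta>\<in>sphere 0 1. carleson_ratio \<gamma> \<mu> \<zeta> r < ennreal \<epsilon>)"

lemma herm_self: "herm z z = complex_of_real ((norm z)\<^sup>2)"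
  by (simp add: herm_def norm_vec_def L2_set_def sum_nonneg flip: complex_norm_square)

lemma herm_linear:
  "herm (x + y) w = herm x w + herm y w" "herm (x - y) w = herm x w - herm y w"
  "herm (c *s x) w = c * herm x w" "herm (r *\<^sub>R x) w = complex_of_real r * herm x w"
  "herm w (x + y) = herm w x + herm w y" "herm w (x - y) = herm w x - herm w y"
  "herm w (c *s x) = cnj c * herm w x" "herm w (r *\<^sub>R x) = complex_of_real r * herm w x"
  by (simp_all add: herm_def algebra_simps sum.distrib sum_subtractf sum_distrib_left
      scaleR_conv_of_real[where 'a = complex])

lemma herm_zero [simp]: "herm 0 w = 0" "herm w 0 = 0"
  by (simp_all add: herm_def)

lemma cnj_herm: "cnj (herm z w) = herm w z"
  by (simp add: herm_def mult.commute)

lemma norm_herm_le: "cmod (herm z w) \<le> norm z * norm w"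
proof -
  have "cmod (herm z w) \<le> (\<Sum>j\<in>UNIV. \<bar>cmod (z $ j)\<bar> * \<bar>cmod (w $ j)\<bar>)"
    unfolding herm_def by (rule order_trans[OF norm_sum]) (simp add: norm_mult)
  also have "\<dots> \<le> norm z * norm w"
    unfolding norm_vec_def by (rule L2_set_mult_ineq)
  finally show ?thesis .
qed

lemma herm_neq_1: "norm z < 1 \<Longrightarrow> norm w < 1 \<Longrightarrow> herm w z \<noteq> 1"
  using norm_herm_le[of w z] mult_strict_mono'[of "norm w" 1 "norm z" 1] by auto

lemma ball_involution_0: "ball_involution z 0 = z"
  by (simp add: ball_involution_def line_proj_def)

lemma ball_involution_self:
  assumes "norm z < 1"
  shows "ball_involution z z = 0"
proof (cases "z = 0")
  case False
  then have "line_proj z z = z" by (simp add: line_proj_def herm_self)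
  then show ?thesis by (simp add: ball_involution_def)
qed (simp add: ball_involution_0)

lemma norm_ball_involution:
  assumes z: "norm z < 1" and w: "norm w < 1"
  shows "1 - (norm (ball_involution z w))\<^sup>2
    = (1 - (norm z)\<^sup>2) * (1 - (norm w)\<^sup>2) / (cmod (1 - herm w z))\<^sup>2"
proof (cases "z = 0")
  case True
  then show ?thesis by (simp add: ball_involution_def line_proj_def)
next
  case False
  define c where "c = herm w z"
  define t where "t = herm z z"
  define s where "s = complex_of_real (sqrt (1 - (norm z)\<^sup>2))"
  have t: "t \<noteq> 0" using False by (simp add: t_def herm_self)
  have c: "1 - c \<noteq> 0" "1 - cnj c \<noteq> 0"
    using herm_neq_1[OF z w] by (auto simp: c_def complex_eq_iff)
  have s2: "s * s = 1 - t"
  proof -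
    have "sqrt (1 - (norm z)\<^sup>2) * sqrt (1 - (norm z)\<^sup>2) = 1 - (norm z)\<^sup>2"
      using z by (simp add: abs_square_le_1)
    then show ?thesis by (simp only: s_def t_def herm_self flip: of_real_mult) simp
  qed
  have cnj_t: "cnj t = t" by (simp add: t_def cnj_herm)
  have zw: "herm z w = cnj c" by (simp add: c_def cnj_herm)
  have aux: "1 - x = y / d" if "x * d = d - y" "d \<noteq> 0" for x y d :: complex
    using that by (simp add: field_simps)
  define q where "q = w - (c/t) *s z"
  define v where "v = (1 - c/t) *s z - sqrt (1 - (norm z)\<^sup>2) *\<^sub>R q"
  have qz: "herm q z = 0" "herm z q = 0"
    using t by (simp_all add: q_def herm_linear cnj_t zw flip: c_def t_def)
  have "herm q q = herm w q"
    using qz by (subst (1) q_def) (simp add: herm_linear)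
  also have "\<dots> = herm w w - c * cnj c / t"
    by (simp add: q_def herm_linear cnj_t flip: c_def)
  finally have qq: "herm q q = herm w w - c * cnj c / t" .
  have inv: "ball_involution z w = inverse (1 - c) *s v"
    by (simp add: ball_involution_def line_proj_def v_def q_def vec_eq_iff algebra_simps
        flip: c_def t_def)
  have "herm v v = (1 - c/t) * (1 - cnj c/t) * t + (s * s) * herm q q"
    using t by (simp add: v_def herm_linear qz cnj_t flip: t_def s_def) (simp add: field_simps)
  moreover have "herm (ball_involution z w) (ball_involution z w) = herm v v / ((1 - c) * (1 - cnj c))"
    by (simp add: inv herm_linear divide_inverse)
  moreover have "(1 - c) * (1 - cnj c) \<noteq> 0"
    using c by simp
  ultimately have "herm (ball_involution z w) (ball_involution z w) * ((1 - c) * (1 - cnj c))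
      = (1 - c/t) * (1 - cnj c/t) * t + (s * s) * (herm w w - c * cnj c / t)"
    by (metis qq nonzero_eq_divide_eq)
  also have "\<dots> = (1 - c) * (1 - cnj c) - (1 - t) * (1 - herm w w)"
    unfolding s2 using t by (simp add: field_simps)
  finally have "1 - herm (ball_involution z w) (ball_involution z w)
      = (1 - t) * (1 - herm w w) / ((1 - c) * (1 - cnj c))"
    using c aux by simp
  also have "(1 - c) * (1 - cnj c) = complex_of_real ((cmod (1 - c))\<^sup>2)"
    by (simp only: complex_norm_square) simp
  finally have "complex_of_real (1 - (norm (ball_involution z w))\<^sup>2)
      = complex_of_real ((1 - (norm z)\<^sup>2) * (1 - (norm w)\<^sup>2) / (cmod (1 - c))\<^sup>2)"
    by (simp add: herm_self t_def)
  then show ?thesis unfolding c_def of_real_eq_iff .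
qed

lemma ball_involution_in_ball:
  assumes z: "norm z < 1" and w: "norm w < 1"
  shows "norm (ball_involution z w) < 1"
proof -
  have "0 < (1 - (norm z)\<^sup>2) * (1 - (norm w)\<^sup>2) / (cmod (1 - herm w z))\<^sup>2"
    using herm_neq_1[OF z w] z w by (simp add: abs_square_less_1)
  then have "(norm (ball_involution z w))\<^sup>2 < 1"
    using norm_ball_involution[OF z w] by simp
  then show ?thesis by (simp add: abs_square_less_1)
qed

lemma ball_involution_involutive:
  assumes z: "norm z < 1" and w: "norm w < 1"
  shows "ball_involution z (ball_involution z w) = w"
proof (cases "z = 0")
  case True
  then show ?thesis by (simp add: ball_involution_def line_proj_def)
next
  case False
  define c where "c = herm w z"
  define t where "t = herm z z"
  define s where "s = complex_of_real (sqrt (1 - (norm z)\<^sup>2))"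
  define u where "u = ball_involution z w"
  have t: "t \<noteq> 0" using False by (simp add: t_def herm_self)
  have c: "1 - c \<noteq> 0" using herm_neq_1[OF z w] by (simp add: c_def)
  have s2: "s * s = 1 - t"
  proof -
    have "sqrt (1 - (norm z)\<^sup>2) * sqrt (1 - (norm z)\<^sup>2) = 1 - (norm z)\<^sup>2"
      using z by (simp add: abs_square_le_1)
    then show ?thesis by (simp only: s_def t_def herm_self flip: of_real_mult) simp
  qed
  have t1: "1 - t \<noteq> 0" using herm_neq_1[OF z z] by (simp add: t_def)
  have "herm (line_proj z w) z = c"
    using t by (simp add: line_proj_def herm_linear flip: c_def t_def)
  then have uz: "herm u z = (t - c) / (1 - c)"
    by (simp add: u_def ball_involution_def herm_linear divide_inverse algebra_simps
        flip: c_def t_def)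
  have d: "1 - herm u z = (1 - t) / (1 - c)"
    using c by (simp add: uz field_simps)
  have u: "u $ i = (z $ i - c/t * z $ i - s * (w $ i - c/t * z $ i)) / (1 - c)" for i
    by (simp add: u_def ball_involution_def line_proj_def scaleR_conv_of_real[where 'a = complex] divide_inverse
        algebra_simps flip: c_def t_def s_def)
  have "ball_involution z u $ i = w $ i" for i
  proof -
    define p where "p = z $ i / t"
    have zi: "z $ i = t * p" using t by (simp add: p_def)
    have "ball_involution z u $ i
        = (z $ i - herm u z/t * z $ i - s * (u $ i - herm u z/t * z $ i)) / (1 - herm u z)"
      by (simp add: ball_involution_def line_proj_def scaleR_conv_of_real[where 'a = complex] divide_inverse
          algebra_simps flip: t_def s_def)
    also have "\<dots> = (t * p - (t - c) / (1 - c) * p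
        - s * ((t * p - c * p - s * (w $ i - c * p)) / (1 - c) - (t - c) / (1 - c) * p))
        / ((1 - t) / (1 - c))"
      unfolding d unfolding uz u zi using t by simp
    also have "\<dots> = ((t * p * (1 - c) - (t - c) * p) + (s * s) * (w $ i - c * p)) / (1 - t)"
      using c t1 by (simp add: divide_simps) (simp add: algebra_simps)
    also have "\<dots> = w $ i" unfolding s2 using t1 by (simp add: divide_simps) (simp add: algebra_simps)
    finally show ?thesis .
  qed
  then show ?thesis by (simp add: vec_eq_iff u_def)
qed

end

theory Submission
  imports Defs
begin

text \<open>
  The formula for \<open>1 - |\<phi>\<^sub>z(w)|\<^sup>2\<close> turns \<open>D(z,R)\<close> into the set where
  \<open>\<kappa> |1 - \<langle>w,z\<rangle>|\<^sup>2 < (1 - |z|\<^sup>2)(1 - |w|\<^sup>2)\<close>, with \<open>\<kappa> = 1 - tanh\<^sup>2 R\<close>.  Hence \<open>D(a,R)\<close> lies in the cube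
  about \<open>a/|a|\<close> of size comparable to \<open>1 - |a|\<^sup>2\<close>, which gives one direction.  For the other, cut
  \<open>Q\<^sub>r(\<zeta>)\<close> into the layers \<open>1 - |z|\<^sup>2 \<approx> \<delta>\<^sub>k = 2 r q\<^sup>k\<close>.  The layer at \<open>\<delta>\<close> is covered by
  \<open>O((r/\<delta>)\<^sup>n)\<close> Bergman balls, so its measure is \<open>O(r\<^sup>n \<delta>\<^sup>n\<^sup>(\<^sup>\<gamma>\<^sup>-\<^sup>1\<^sup>))\<close>, and since \<open>\<gamma> > 1\<close> the sum over the
  layers is a geometric series of size \<open>O(r\<^sup>n\<^sup>\<gamma>)\<close>.
\<close>

section \<open>Bergman balls and Carleson cubes\<close>

text \<open>Call 1 - |z|^2 the depth of z. Two points of nearly equal depth \<delta> are Bergman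
  close once their distance is small against sqrt \<delta> and Im \<langle>w,z\<rangle> is small
  against \<delta>. So a cell has width sqrt \<delta> in the 2n - 2 real tangential directions and
  width \<delta> in one more direction, where the cube has widths sqrt r and r; this is the origin
  of (r/\<delta>)^n. The obstacle is that last direction: Im \<langle>w,z\<rangle> contains a
  tangential term, and inside the cube a tangential move by sqrt \<delta> can change it by sqrt (r
  \<delta>), far more than \<delta>. A grid in Im \<langle>z,\<zeta>\<rangle> alone therefore fails,
  and the imaginary part has to be measured against a point of the cell itself. With q near 1 and a
  fine mesh this works for every R > 0, so balls of any one radius control the cubes. The estimates
  concern only the region near the sphere; for boundedness the rest of the ball is absorbed by the
  total mass, whose finiteness needs its own argument in each direction.\<close>

lemma inner_eq_Re_herm: "x \<bullet> y = Re (herm x y)"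
  by (simp add: herm_def inner_vec_def inner_complex_def)

lemma continuous_on_herm [continuous_intros]:
  "continuous_on S f \<Longrightarrow> continuous_on S g \<Longrightarrow> continuous_on S (\<lambda>x. herm (f x) (g x))"
  unfolding herm_def by (intro continuous_intros)

lemma one_minus_norm_le: "norm w \<le> 1 \<Longrightarrow> norm z \<le> 1 \<Longrightarrow> 1 - norm z \<le> cmod (1 - herm z w)"
proof -
  assume w: "norm w \<le> 1" and z: "norm z \<le> 1"
  have "cmod (herm z w) \<le> norm z"
    using norm_herm_le[of z w] mult_left_mono[OF w, of "norm z"] by simp
  then show ?thesis using norm_triangle_ineq2[of 1 "herm z w"] by simp
qed

lemma one_minus_norm_sq_bounds:
  "norm z < 1 \<Longrightarrow> 0 < 1 - (norm z)\<^sup>2"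
  "norm z < 1 \<Longrightarrow> 1 - norm z \<le> 1 - (norm z)\<^sup>2"
  "1 - (norm z)\<^sup>2 \<le> 2 * (1 - norm z)" for z :: "complex ^ 'n"
proof -
  show "0 < 1 - (norm z)\<^sup>2" if "norm z < 1" using that by (simp add: abs_square_less_1)
  show "1 - norm z \<le> 1 - (norm z)\<^sup>2" if "norm z < 1"
    using that by (simp add: power2_eq_square mult_left_le)
  have "0 \<le> (1 - norm z)\<^sup>2" by simp
  then show "1 - (norm z)\<^sup>2 \<le> 2 * (1 - norm z)" by (simp add: power2_diff)
qed

lemma artanh_less_iff:
  fixes x y :: real
  assumes "-1 < x" "x < 1" "-1 < y" "y < 1"
  shows "artanh x < artanh y \<longleftrightarrow> x < y"
proof -
  have "artanh x < artanh y \<longleftrightarrow> (1 + x) / (1 - x) < (1 + y) / (1 - y)"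
    using assms by (simp add: artanh_def)
  also have "\<dots> \<longleftrightarrow> x < y"
    using assms by (simp add: divide_less_eq less_divide_eq) (simp add: algebra_simps)
  finally show ?thesis .
qed

text \<open>The Bergman metric is artanh |\<phi>_z(w)|, so R enters only through tanh R. Cleared of
  denominators, the condition is visibly open in w and allows a factor to be cancelled in the
  comparison with cubes.\<close>

lemma bergman_ball_eq:
  assumes R: "R > 0" and z: "norm z < 1"
  shows "bergman_ball z R = {w \<in> ball 0 1.
    (1 - (tanh R)\<^sup>2) * (cmod (1 - herm w z))\<^sup>2 < (1 - (norm z)\<^sup>2) * (1 - (norm w)\<^sup>2)}"
proof -
  have "bergman_metric z w < R \<longleftrightarrow>
      (1 - (tanh R)\<^sup>2) * (cmod (1 - herm w z))\<^sup>2 < (1 - (norm z)\<^sup>2) * (1 - (norm w)\<^sup>2)"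
    if w: "norm w < 1" for w
  proof -
    define x where "x = norm (ball_involution z w)"
    have x: "0 \<le> x" "x < 1" using ball_involution_in_ball[OF z w] by (auto simp: x_def)
    have "bergman_metric z w = artanh x"
      by (simp add: bergman_metric_def artanh_def x_def)
    moreover have "artanh x < artanh (tanh R) \<longleftrightarrow> x < tanh R"
      using x R by (intro artanh_less_iff) (auto simp: tanh_real_lt_1 intro: less_trans[of "-1" 0])
    ultimately have "bergman_metric z w < R \<longleftrightarrow> x < tanh R"
      by (simp add: artanh_tanh_real)
    also have "\<dots> \<longleftrightarrow> x\<^sup>2 < (tanh R)\<^sup>2"
      using x R by (auto simp: power2_less_eq_zero_iff intro: power_strict_mono dest: power2_less_imp_less)
    also have "\<dots> \<longleftrightarrow> 1 - (tanh R)\<^sup>2 < (1 - (norm z)\<^sup>2) * (1 - (norm w)\<^sup>2) / (cmod (1 - herm w z))\<^sup>2"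
      using norm_ball_involution[OF z w] by (auto simp: x_def)
    also have "\<dots> \<longleftrightarrow> (1 - (tanh R)\<^sup>2) * (cmod (1 - herm w z))\<^sup>2 < (1 - (norm z)\<^sup>2) * (1 - (norm w)\<^sup>2)"
      using herm_neq_1[OF z w] by (subst pos_less_divide_eq) auto
    finally show ?thesis .
  qed
  then show ?thesis by (auto simp: bergman_ball_def)
qed

lemma tanh_sq_bounds:
  fixes R :: real
  assumes "R > 0"
  shows "0 < 1 - (tanh R)\<^sup>2" "1 - (tanh R)\<^sup>2 < 1"
  using assms tanh_real_lt_1[of R] by (auto simp: abs_square_less_1)

lemma open_bergman_ball:
  assumes "R > 0" "norm z < 1"
  shows "open (bergman_ball z R)"
proof -
  have "open {w. (1 - (tanh R)\<^sup>2) * (cmod (1 - herm w z))\<^sup>2 < (1 - (norm z)\<^sup>2) * (1 - (norm w)\<^sup>2)}"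
    by (intro open_Collect_less continuous_intros)
  moreover have "bergman_ball z R = ball 0 1 \<inter> {w. (1 - (tanh R)\<^sup>2) * (cmod (1 - herm w z))\<^sup>2 < (1 - (norm z)\<^sup>2) * (1 - (norm w)\<^sup>2)}"
    by (auto simp: bergman_ball_eq[OF assms])
  ultimately show ?thesis by auto
qed

lemma open_carleson_cube: "open (carleson_cube \<zeta> r)"
proof -
  have "open {z. cmod (1 - herm z \<zeta>) < r}" by (intro open_Collect_less continuous_intros)
  moreover have "carleson_cube \<zeta> r = ball 0 1 \<inter> {z. cmod (1 - herm z \<zeta>) < r}"
    by (auto simp: carleson_cube_def)
  ultimately show ?thesis by auto
qed

lemma centre_in_bergman_ball:
  assumes "R > 0" "norm z < 1"
  shows "z \<in> bergman_ball z R"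
  using assms by (simp add: bergman_ball_def bergman_metric_def ball_involution_self)

text \<open>Since 1 - |w|^2 \<le> 2 X for X = |1 - \<langle>w,a\<rangle>|, one factor X cancels from
  the inequality that defines the ball; this yields the summand 2/\<kappa>. The summand 1 pays for
  replacing a by a/|a|, which moves \<open>herm w a\<close> by at most 1 - |a|.\<close>

lemma bergman_ball_subset_carleson_cube:
  assumes R: "R > 0" and a: "norm a < 1" "a \<noteq> 0"
  shows "bergman_ball a R \<subseteq>
    carleson_cube ((1 / norm a) *\<^sub>R a) ((2 / (1 - (tanh R)\<^sup>2) + 1) * (1 - (norm a)\<^sup>2))"
proof
  define \<kappa> where "\<kappa> = 1 - (tanh R)\<^sup>2"
  have \<kappa>: "0 < \<kappa>" using tanh_sq_bounds[OF R] by (simp add: \<kappa>_def)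
  fix w assume "w \<in> bergman_ball a R"
  then have w: "norm w < 1" and *: "\<kappa> * (cmod (1 - herm w a))\<^sup>2 < (1 - (norm a)\<^sup>2) * (1 - (norm w)\<^sup>2)"
    by (auto simp: bergman_ball_eq[OF R a(1)] \<kappa>_def)
  define X where "X = cmod (1 - herm w a)"
  have X: "0 < X" using herm_neq_1[OF a(1) w] by (simp add: X_def)
  have "1 - (norm w)\<^sup>2 \<le> 2 * X"
    using one_minus_norm_le[of a w] one_minus_norm_sq_bounds(3)[of w] w a by (simp add: X_def)
  then have "(1 - (norm a)\<^sup>2) * (1 - (norm w)\<^sup>2) \<le> (1 - (norm a)\<^sup>2) * (2 * X)"
    using one_minus_norm_sq_bounds(1)[of a] a by (intro mult_left_mono) auto
  with * have "\<kappa> * X\<^sup>2 < (1 - (norm a)\<^sup>2) * (2 * X)"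
    unfolding X_def by (rule less_le_trans)
  then have "(\<kappa> * X) * X < ((1 - (norm a)\<^sup>2) * 2) * X"
    by (simp only: power2_eq_square mult.assoc)
  then have "\<kappa> * X < (1 - (norm a)\<^sup>2) * 2" using X by (simp add: mult_less_cancel_right)
  then have 1: "X < 2 / \<kappa> * (1 - (norm a)\<^sup>2)" using \<kappa> by (simp add: field_simps)
  have "herm w a - herm w ((1 / norm a) *\<^sub>R a) = complex_of_real (1 - 1 / norm a) * herm w a"
    by (simp add: herm_linear algebra_simps)
  then have "cmod (herm w a - herm w ((1 / norm a) *\<^sub>R a)) = \<bar>1 - 1 / norm a\<bar> * cmod (herm w a)"
    by (simp add: norm_mult flip: of_real_diff of_real_divide)
  also have "\<dots> \<le> \<bar>1 - 1 / norm a\<bar> * norm a"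
  proof -
    have "cmod (herm w a) \<le> 1 * norm a"
      by (rule order_trans[OF norm_herm_le]) (use w in \<open>intro mult_right_mono, auto\<close>)
    then show ?thesis by (intro mult_left_mono) auto
  qed
  also have "\<dots> = 1 - norm a" using a by (simp add: abs_if field_simps)
  also have "\<dots> \<le> 1 - (norm a)\<^sup>2" by (rule one_minus_norm_sq_bounds) fact
  finally have 2: "cmod (herm w a - herm w ((1 / norm a) *\<^sub>R a)) \<le> 1 - (norm a)\<^sup>2" .
  have "cmod (1 - herm w ((1 / norm a) *\<^sub>R a)) \<le> X + cmod (herm w a - herm w ((1 / norm a) *\<^sub>R a))"
    using norm_triangle_ineq[of "1 - herm w a" "herm w a - herm w ((1 / norm a) *\<^sub>R a)"]
    by (simp add: X_def)
  with 1 2 have "cmod (1 - herm w ((1 / norm a) *\<^sub>R a)) < (2 / \<kappa> + 1) * (1 - (norm a)\<^sup>2)"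
    by (simp add: algebra_simps)
  then show "w \<in> carleson_cube ((1 / norm a) *\<^sub>R a) ((2 / (1 - (tanh R)\<^sup>2) + 1) * (1 - (norm a)\<^sup>2))"
    using w by (simp add: carleson_cube_def \<kappa>_def)
qed

section \<open>A sufficient condition for Bergman closeness\<close>

text \<open>Polarisation: for points of known depth the Euclidean distance already controls the real
  part, so only the imaginary part needs further information.\<close>

lemma Re_one_minus_herm:
  "2 * Re (1 - herm z w) = (1 - (norm z)\<^sup>2) + (1 - (norm w)\<^sup>2) + (norm (z - w))\<^sup>2"
proof -
  have "(norm (z - w))\<^sup>2 = (norm z)\<^sup>2 + (norm w)\<^sup>2 - 2 * (z \<bullet> w)"
    by (simp add: power2_norm_eq_inner inner_diff inner_commute algebra_simps)
  then show ?thesis by (simp add: inner_eq_Re_herm)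
qed

text \<open>The subtraction of \<open>p\<close> makes the quadratic error term small; this is the shear of the
  Heisenberg group law.\<close>

lemma Im_herm_shift:
  "Im (herm z w) = Im (herm (z - p) (w - p)) + (Im (herm z p) - Im (herm w p))"
proof -
  have "Im (herm p p) = 0" by (simp add: herm_self)
  moreover have "Im (herm p w) = - Im (herm w p)" by (simp flip: cnj_herm[of w p])
  ultimately show ?thesis by (simp add: herm_linear)
qed

text \<open>At depths between q \<delta> and \<delta> the right side of
  \<open>bergman_ball_eq\<close> is at least q^2 \<delta>^2, while Re (1 - \<langle>w,z\<rangle>) is
  at most (1 + 2 e^2) \<delta> and the imaginary part at most 2 e \<delta>. The 12 comes from (1 + 2
  e^2)^2 + 4 e^2 \<le> 1 + 12 e^2 for e \<le> 1. The auxiliary point \<open>p\<close> lets two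
  points of a cell be compared through their common representative.\<close>

lemma mem_bergman_ball_of_near:
  assumes R: "R > 0" and z: "norm z < 1" and w: "norm w < 1" and \<delta>: "0 < \<delta>"
    and e: "0 < e" "e \<le> 1" and q: "0 < q"
    and qe: "(1 - (tanh R)\<^sup>2) * (1 + 12 * e\<^sup>2) < q\<^sup>2"
    and zl: "q * \<delta> < 1 - (norm z)\<^sup>2" "1 - (norm z)\<^sup>2 \<le> \<delta>"
    and wl: "q * \<delta> < 1 - (norm w)\<^sup>2" "1 - (norm w)\<^sup>2 \<le> \<delta>"
    and zp: "norm (z - p) \<le> e * sqrt \<delta>" and wp: "norm (w - p) \<le> e * sqrt \<delta>"
    and im: "\<bar>Im (herm z p) - Im (herm w p)\<bar> \<le> e * \<delta>"
  shows "w \<in> bergman_ball z R"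
proof -
  have "norm (w - z) \<le> 2 * (e * sqrt \<delta>)"
    using norm_triangle_ineq4[of "w - p" "z - p"] zp wp by simp
  then have "(norm (w - z))\<^sup>2 \<le> (2 * (e * sqrt \<delta>))\<^sup>2" by (intro power_mono) auto
  also have "\<dots> = 4 * e\<^sup>2 * \<delta>" using \<delta> by (simp add: power_mult_distrib)
  finally have re: "Re (1 - herm w z) \<le> (1 + 2 * e\<^sup>2) * \<delta>"
    using Re_one_minus_herm[of w z] zl wl by (simp add: algebra_simps)
  have "2 * Re (1 - herm w z) \<ge> 0"
    unfolding Re_one_minus_herm using zl wl mult_pos_pos[OF q \<delta>]
    by (intro add_nonneg_nonneg) auto
  then have re0: "0 \<le> Re (1 - herm w z)" by simp
  have "\<bar>Im (herm (w - p) (z - p))\<bar> \<le> norm (w - p) * norm (z - p)"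
    using abs_Im_le_cmod norm_herm_le order_trans by blast
  also have "\<dots> \<le> (e * sqrt \<delta>) * (e * sqrt \<delta>)" using zp wp e \<delta> by (intro mult_mono) auto
  also have "\<dots> = e * (e * \<delta>)" using \<delta> by simp
  also have "\<dots> \<le> e * \<delta>" using e \<delta> by (simp add: mult_left_le_one_le)
  finally have "\<bar>Im (1 - herm w z)\<bar> \<le> 2 * e * \<delta>"
    using im Im_herm_shift[of w z p] by simp
  then have "(Im (1 - herm w z))\<^sup>2 \<le> (2 * e * \<delta>)\<^sup>2"
    by (metis abs_ge_zero power2_abs power_mono)
  moreover have "(Re (1 - herm w z))\<^sup>2 \<le> ((1 + 2 * e\<^sup>2) * \<delta>)\<^sup>2"
    using re re0 by (intro power_mono)
  moreover have "((1 + 2 * e\<^sup>2) * \<delta>)\<^sup>2 + (2 * e * \<delta>)\<^sup>2 = ((1 + 2 * e\<^sup>2)\<^sup>2 + 4 * e\<^sup>2) * \<delta>\<^sup>2"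
    by (simp add: power2_eq_square algebra_simps)
  ultimately have "(cmod (1 - herm w z))\<^sup>2 \<le> ((1 + 2 * e\<^sup>2)\<^sup>2 + 4 * e\<^sup>2) * \<delta>\<^sup>2"
    unfolding cmod_power2 by linarith
  also have "\<dots> \<le> (1 + 12 * e\<^sup>2) * \<delta>\<^sup>2"
  proof (intro mult_right_mono)
    have "e\<^sup>2 * e\<^sup>2 \<le> e\<^sup>2 * 1" using e by (intro mult_left_mono) (auto simp: power_le_one)
    moreover have "(1 + 2 * e\<^sup>2)\<^sup>2 = 1 + 4 * e\<^sup>2 + 4 * (e\<^sup>2 * e\<^sup>2)"
      by (simp add: power2_eq_square algebra_simps)
    ultimately show "(1 + 2 * e\<^sup>2)\<^sup>2 + 4 * e\<^sup>2 \<le> 1 + 12 * e\<^sup>2" by linarith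
  qed simp
  finally have "(1 - (tanh R)\<^sup>2) * (cmod (1 - herm w z))\<^sup>2 \<le> (1 - (tanh R)\<^sup>2) * ((1 + 12 * e\<^sup>2) * \<delta>\<^sup>2)"
    using tanh_sq_bounds[OF R] by (intro mult_left_mono) auto
  also have "\<dots> < q\<^sup>2 * \<delta>\<^sup>2"
    using mult_strict_right_mono[OF qe, of "\<delta>\<^sup>2"] \<delta> by (simp add: mult.assoc)
  also have "\<dots> = (q * \<delta>) * (q * \<delta>)" by (simp add: power2_eq_square)
  also have "\<dots> \<le> (1 - (norm z)\<^sup>2) * (1 - (norm w)\<^sup>2)"
    using zl wl mult_pos_pos[OF q \<delta>] by (intro mult_mono) linarith+
  finally show ?thesis using w by (simp add: bergman_ball_eq[OF R z])
qed

section \<open>Covering a layer of a Carleson cube by Bergman balls\<close>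

text \<open>Pigeonhole instead of a volume argument: one point of A is chosen for each key that
  occurs, so the centres lie in A and their number is bounded by the number of possible
  keys.\<close>

lemma finite_net_of_key:
  assumes "finite K" "key ` A \<subseteq> K"
    and "\<And>x y. x \<in> A \<Longrightarrow> y \<in> A \<Longrightarrow> key x = key y \<Longrightarrow> y \<in> D x"
  shows "\<exists>F. finite F \<and> F \<subseteq> A \<and> card F \<le> card K \<and> A \<subseteq> (\<Union>x\<in>F. D x)"
proof (intro exI conjI)
  let ?F = "inv_into A key ` key ` A"
  have fin: "finite (key ` A)" using assms finite_subset by blast
  then show "finite ?F" by blast
  show "?F \<subseteq> A" by (auto intro: inv_into_into)
  show "card ?F \<le> card K"
    using card_image_le[OF fin] card_mono[OF assms(1,2)] order_trans by blast
  show "A \<subseteq> (\<Union>x\<in>?F. D x)"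
  proof
    fix y assume y: "y \<in> A"
    then have "y \<in> D (inv_into A key (key y))"
      by (intro assms(3)) (auto intro: inv_into_into simp: f_inv_into_f)
    with y show "y \<in> (\<Union>x\<in>?F. D x)" by blast
  qed
qed

lemma card_floor_interval:
  fixes c :: real
  assumes "0 \<le> c"
  shows "real (card {\<lfloor>- c\<rfloor>..\<lfloor>c\<rfloor>}) \<le> 2 * c + 2"
proof -
  have "\<lfloor>- c\<rfloor> \<le> \<lfloor>c\<rfloor>" using assms by (intro floor_mono) simp
  then show ?thesis
    by (simp only: card_atLeastAtMost_int) linarith
qed

lemma floor_mem_interval: "\<bar>x\<bar> \<le> c \<Longrightarrow> \<lfloor>x\<rfloor> \<in> {\<lfloor>- c\<rfloor>..\<lfloor>c\<rfloor>}" for x c :: real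
  by (auto intro!: floor_mono)

lemma abs_diff_le_of_floor_eq:
  fixes x y s :: real
  assumes "\<lfloor>x / s\<rfloor> = \<lfloor>y / s\<rfloor>" "0 < s"
  shows "\<bar>x - y\<bar> \<le> s"
proof -
  have "\<bar>x / s - y / s\<bar> \<le> 1" using assms(1) by linarith
  then have "\<bar>(x - y) / s\<bar> \<le> 1" by (simp add: diff_divide_distrib)
  then show ?thesis using assms(2) by (simp add: abs_divide)
qed

section \<open>Coordinates along \<zeta> and orthogonal to it\<close>

definition tangential :: "complex ^ 'n \<Rightarrow> complex ^ 'n \<Rightarrow> complex ^ 'n"
  where "tangential \<zeta> z = z - herm z \<zeta> *s \<zeta>"

lemma herm_tangential:
  assumes "norm \<zeta> = 1"
  shows "herm (tangential \<zeta> z) \<zeta> = 0"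
    "herm z w = herm z \<zeta> * cnj (herm w \<zeta>) + herm (tangential \<zeta> z) (tangential \<zeta> w)"
proof -
  have "herm \<zeta> \<zeta> = 1" using assms by (simp add: herm_self)
  then show "herm (tangential \<zeta> z) \<zeta> = 0"
    "herm z w = herm z \<zeta> * cnj (herm w \<zeta>) + herm (tangential \<zeta> z) (tangential \<zeta> w)"
    by (simp_all add: tangential_def herm_linear algebra_simps cnj_herm)
qed

lemma tangential_diff: "tangential \<zeta> (z - w) = tangential \<zeta> z - tangential \<zeta> w"
  by (simp add: tangential_def herm_linear vec_eq_iff algebra_simps)

lemma norm_sq_tangential:
  assumes "norm \<zeta> = 1"
  shows "(norm z)\<^sup>2 = (Re (herm z \<zeta>))\<^sup>2 + (Im (herm z \<zeta>))\<^sup>2 + (norm (tangential \<zeta> z))\<^sup>2"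
proof -
  have "complex_of_real ((norm z)\<^sup>2) =
      complex_of_real ((cmod (herm z \<zeta>))\<^sup>2 + (norm (tangential \<zeta> z))\<^sup>2)"
    using herm_tangential(2)[OF assms, of z z]
    by (simp only: herm_self of_real_add complex_norm_square)
  then have "(norm z)\<^sup>2 = (cmod (herm z \<zeta>))\<^sup>2 + (norm (tangential \<zeta> z))\<^sup>2"
    unfolding of_real_eq_iff .
  then show ?thesis by (simp add: cmod_power2)
qed

text \<open>The dimension bound comes from adjoining the two real directions \<zeta> and \<i>\<zeta>
  to an orthonormal basis of the complex orthogonal complement: the enlarged set is still
  orthogonal, hence independent in real dimension 2n. The norm is bounded by a sum of coordinates
  because a grid controls coordinates one at a time.\<close>

lemma tangent_space_basis:
  fixes \<zeta> :: "complex ^ 'n"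
  assumes \<zeta>: "norm \<zeta> = 1"
  obtains B where "finite B" "card B + 2 \<le> 2 * CARD('n)" "\<And>b. b \<in> B \<Longrightarrow> norm b = 1"
    "\<And>v. herm v \<zeta> = 0 \<Longrightarrow> norm v \<le> (\<Sum>b\<in>B. \<bar>v \<bullet> b\<bar>)"
proof -
  let ?T = "{v. herm v \<zeta> = 0}"
  have sub: "subspace ?T" by (simp add: subspace_def herm_linear)
  obtain B where B: "B \<subseteq> ?T" "pairwise orthogonal B" "\<And>b. b \<in> B \<Longrightarrow> norm b = 1"
    "independent B" "span B = ?T"
    using orthonormal_basis_subspace[OF sub] by metis
  have fin: "finite B" using B(4) independent_imp_finite by blast
  have \<zeta>\<zeta>: "herm \<zeta> \<zeta> = 1" using \<zeta> by (simp add: herm_self)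
  have i_notin: "\<i> *s \<zeta> \<notin> B" "\<zeta> \<notin> B" using B(1) \<zeta>\<zeta> by (auto simp: herm_linear)
  have ne: "\<i> *s \<zeta> \<noteq> \<zeta>"
  proof
    assume "\<i> *s \<zeta> = \<zeta>"
    then have "herm (\<i> *s \<zeta>) \<zeta> = herm \<zeta> \<zeta>" by simp
    then show False by (simp add: herm_linear \<zeta>\<zeta> complex_eq_iff)
  qed
  have orth: "b \<bullet> \<zeta> = 0" "b \<bullet> (\<i> *s \<zeta>) = 0" if "b \<in> B" for b
    using that B(1) by (auto simp: inner_eq_Re_herm herm_linear)
  have "\<zeta> \<bullet> (\<i> *s \<zeta>) = 0" by (simp add: inner_eq_Re_herm herm_linear \<zeta>\<zeta>)
  then have "pairwise orthogonal (insert \<zeta> (insert (\<i> *s \<zeta>) B))"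
    using B(2) orth by (auto simp: pairwise_insert orthogonal_def inner_commute)
  moreover have "0 \<notin> insert \<zeta> (insert (\<i> *s \<zeta>) B)"
  proof -
    have "herm (\<i> *s \<zeta>) \<zeta> \<noteq> 0" by (simp add: herm_linear \<zeta>\<zeta>)
    then have "\<i> *s \<zeta> \<noteq> 0" by (metis herm_zero(1))
    then show ?thesis using B(3)[of 0] \<zeta> by auto
  qed
  ultimately have "independent (insert \<zeta> (insert (\<i> *s \<zeta>) B))"
    by (rule pairwise_orthogonal_independent)
  then have "card (insert \<zeta> (insert (\<i> *s \<zeta>) B)) \<le> DIM(complex ^ 'n)"
    using independent_bound by blast
  moreover have "card (insert \<zeta> (insert (\<i> *s \<zeta>) B)) = card B + 2"
    using fin i_notin ne by simp
  ultimately have card: "card B + 2 \<le> 2 * CARD('n)" by simp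
  show thesis
  proof (rule that[OF fin card B(3)])
    fix v assume "herm v \<zeta> = 0"
    then have "v \<in> span B" using B(5) by simp
    then have "(\<Sum>b\<in>B. (v \<bullet> b) *\<^sub>R b) = v"
      using B fin by (intro orthonormal_basis_expand) auto
    then have "norm v \<le> (\<Sum>b\<in>B. norm ((v \<bullet> b) *\<^sub>R b))" by (metis norm_sum)
    also have "\<dots> = (\<Sum>b\<in>B. \<bar>v \<bullet> b\<bar>)" using B(3) by (intro sum.cong) auto
    finally show "norm v \<le> (\<Sum>b\<in>B. \<bar>v \<bullet> b\<bar>)" .
  qed
qed

text \<open>The cube is anisotropic: of size r in \<langle>z,\<zeta>\<rangle>, but of size sqrt r
  tangentially, because |z| < 1 leaves at most 1 - |\<langle>z,\<zeta>\<rangle>|^2 \<le> 2 (1 -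
  |\<langle>z,\<zeta>\<rangle>|) for the square of the tangential part.\<close>

lemma carleson_cube_coords:
  assumes \<zeta>: "norm \<zeta> = 1" and r: "r \<le> 1/2" and z: "z \<in> carleson_cube \<zeta> r"
  shows "1/2 \<le> Re (herm z \<zeta>)" "Re (herm z \<zeta>) \<le> 1" "\<bar>Im (herm z \<zeta>)\<bar> \<le> r"
    "norm (tangential \<zeta> z) \<le> sqrt (2 * r)" "1 - (norm z)\<^sup>2 < 2 * r" "norm z < 1"
proof -
  show n: "norm z < 1" using z by (simp add: carleson_cube_def)
  have c: "cmod (1 - herm z \<zeta>) < r" using z by (simp add: carleson_cube_def)
  show "1/2 \<le> Re (herm z \<zeta>)" using complex_Re_le_cmod[of "1 - herm z \<zeta>"] c r by simp
  have h: "cmod (herm z \<zeta>) \<le> 1" using norm_herm_le[of z \<zeta>] n \<zeta> by simp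
  then show "Re (herm z \<zeta>) \<le> 1" using complex_Re_le_cmod order_trans by blast
  show "\<bar>Im (herm z \<zeta>)\<bar> \<le> r" using abs_Im_le_cmod[of "1 - herm z \<zeta>"] c by simp
  have "1 - cmod (herm z \<zeta>) \<le> cmod (1 - herm z \<zeta>)"
    using norm_triangle_ineq2[of 1 "herm z \<zeta>"] by simp
  moreover have "0 \<le> (1 - cmod (herm z \<zeta>))\<^sup>2" by simp
  moreover have "(norm z)\<^sup>2 < 1" using n by (simp add: abs_square_less_1)
  ultimately have "(norm (tangential \<zeta> z))\<^sup>2 \<le> 2 * r"
    using norm_sq_tangential[OF \<zeta>, of z] c by (simp add: power2_diff flip: cmod_power2)
  then show "norm (tangential \<zeta> z) \<le> sqrt (2 * r)" by (rule real_le_rsqrt)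
  show "1 - (norm z)\<^sup>2 < 2 * r"
    using one_minus_norm_le[of \<zeta> z] one_minus_norm_sq_bounds(3)[of z] c n \<zeta> by simp
qed

lemma abs_diff_squares: "\<bar>x\<^sup>2 - y\<^sup>2\<bar> = \<bar>x - y\<bar> * \<bar>x + y\<bar>" for x y :: real
  by (simp only: abs_mult[symmetric]) (simp add: power2_eq_square algebra_simps)

text \<open>The real part of \<langle>z,\<zeta>\<rangle> is recovered from the other data: its
  square equals |z|^2 minus the squares of the imaginary part and of the tangential norm, each of
  which varies little over the cell. The second bound gives the range that the finer grid in Im
  \<langle>z,p\<rangle> has to cover.\<close>

lemma cell_bounds:
  assumes \<zeta>: "norm \<zeta> = 1" and r: "0 < r" "r \<le> 1/2"
    and z: "z \<in> carleson_cube \<zeta> r" and p: "p \<in> carleson_cube \<zeta> r"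
    and \<delta>: "\<bar>(norm z)\<^sup>2 - (norm p)\<^sup>2\<bar> \<le> \<delta>"
    and im: "\<bar>Im (herm z \<zeta>) - Im (herm p \<zeta>)\<bar> \<le> s"
    and tg: "norm (tangential \<zeta> z - tangential \<zeta> p) \<le> t"
  shows "norm (z - p) \<le> \<delta> + 2 * r * s + 2 * t * sqrt (2 * r) + s + t"
    "\<bar>Im (herm z p)\<bar> \<le> min s (2 * r) + r * (\<delta> + 2 * r * s + 2 * t * sqrt (2 * r)) + t * sqrt (2 * r)"
proof -
  note cz = carleson_cube_coords[OF \<zeta> r(2) z] and cp = carleson_cube_coords[OF \<zeta> r(2) p]
  define a b where "a = herm z \<zeta>" and "b = herm p \<zeta>"
  define v w where "v = tangential \<zeta> z" and "w = tangential \<zeta> p"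
  have ident: "(Re a)\<^sup>2 - (Re b)\<^sup>2
      = ((norm z)\<^sup>2 - (norm p)\<^sup>2) - ((Im a)\<^sup>2 - (Im b)\<^sup>2) - ((norm v)\<^sup>2 - (norm w)\<^sup>2)"
    using norm_sq_tangential[OF \<zeta>, of z] norm_sq_tangential[OF \<zeta>, of p]
    by (simp add: a_def b_def v_def w_def)
  have t0: "0 \<le> t" using tg norm_ge_zero order_trans by blast
  have s0: "0 \<le> s" using im by linarith
  have "\<bar>(Im a)\<^sup>2 - (Im b)\<^sup>2\<bar> = \<bar>Im a - Im b\<bar> * \<bar>Im a + Im b\<bar>"
    by (rule abs_diff_squares)
  also have "\<dots> \<le> s * (2 * r)"
    using im cz cp s0 by (intro mult_mono) (auto simp: a_def b_def)
  finally have 1: "\<bar>(Im a)\<^sup>2 - (Im b)\<^sup>2\<bar> \<le> 2 * r * s" by (simp add: mult_ac)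
  have "\<bar>(norm v)\<^sup>2 - (norm w)\<^sup>2\<bar> = \<bar>norm v - norm w\<bar> * \<bar>norm v + norm w\<bar>"
    by (rule abs_diff_squares)
  also have "\<dots> \<le> t * (2 * sqrt (2 * r))"
    using norm_triangle_ineq3[of v w] tg cz cp t0 by (intro mult_mono) (auto simp: v_def w_def)
  finally have 2: "\<bar>(norm v)\<^sup>2 - (norm w)\<^sup>2\<bar> \<le> 2 * t * sqrt (2 * r)" by (simp add: mult_ac)
  \<comment> \<open>Both real parts are at least 1/2, so their sum is at least 1 and a bound for the
    difference of squares passes to the difference itself.\<close>
  have "\<bar>Re a - Re b\<bar> * 1 \<le> \<bar>Re a - Re b\<bar> * \<bar>Re a + Re b\<bar>"
    using cz cp by (intro mult_left_mono) (auto simp: a_def b_def)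
  also have "\<dots> = \<bar>(Re a)\<^sup>2 - (Re b)\<^sup>2\<bar>"
    by (rule abs_diff_squares[symmetric])
  finally have re: "\<bar>Re a - Re b\<bar> \<le> \<delta> + 2 * r * s + 2 * t * sqrt (2 * r)"
    using abs_triangle_ineq4[of "(norm z)\<^sup>2 - (norm p)\<^sup>2 - ((Im a)\<^sup>2 - (Im b)\<^sup>2)" "(norm v)\<^sup>2 - (norm w)\<^sup>2"]
      abs_triangle_ineq4[of "(norm z)\<^sup>2 - (norm p)\<^sup>2" "(Im a)\<^sup>2 - (Im b)\<^sup>2"] 1 2 \<delta>
    unfolding ident by (simp only: mult_1_right)
  have ab: "cmod (a - b) \<le> \<delta> + 2 * r * s + 2 * t * sqrt (2 * r) + s"
    using cmod_le[of "a - b"] re im by (simp add: a_def b_def)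
  have "(norm (z - p))\<^sup>2 = (cmod (a - b))\<^sup>2 + (norm (v - w))\<^sup>2"
    using norm_sq_tangential[OF \<zeta>, of "z - p"]
    by (simp add: cmod_power2 a_def b_def v_def w_def tangential_diff herm_linear)
  also have "\<dots> \<le> (cmod (a - b) + norm (v - w))\<^sup>2" by (simp add: power2_sum)
  finally have "norm (z - p) \<le> cmod (a - b) + norm (v - w)"
    by (rule power2_le_imp_le) simp
  then show "norm (z - p) \<le> \<delta> + 2 * r * s + 2 * t * sqrt (2 * r) + s + t"
    using ab tg by (simp add: v_def w_def)
  \<comment> \<open>Since \<langle>p,p\<rangle> is real, one argument may be replaced by z - p,
    which is small.\<close>
  have "Im (herm p p) = 0" by (simp add: herm_self)
  then have "Im (herm z p) = Im (herm (z - p) p)" by (simp add: herm_linear)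
  also have "herm (z - p) p = (a - b) * cnj b + herm (v - w) w"
    using herm_tangential(2)[OF \<zeta>, of "z - p" p]
    by (simp add: a_def b_def v_def w_def tangential_diff herm_linear)
  finally have I: "Im (herm z p) = (Im a - Im b) * Re b - (Re a - Re b) * Im b + Im (herm (v - w) w)"
    by simp
  \<comment> \<open>The grid bounds the difference by s, the cube itself by 2 r.\<close>
  have "\<bar>(Im a - Im b) * Re b\<bar> \<le> min s (2 * r) * 1"
    unfolding abs_mult using im cz cp s0 r by (intro mult_mono) (auto simp: a_def b_def)
  moreover have "\<bar>(Re a - Re b) * Im b\<bar> \<le> (\<delta> + 2 * r * s + 2 * t * sqrt (2 * r)) * r"
    unfolding abs_mult using re cp s0 r by (intro mult_mono) (auto simp: b_def)
  moreover have "\<bar>Im (herm (v - w) w)\<bar> \<le> t * sqrt (2 * r)"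
  proof -
    have "\<bar>Im (herm (v - w) w)\<bar> \<le> norm (v - w) * norm w"
      using abs_Im_le_cmod norm_herm_le order_trans by blast
    also have "\<dots> \<le> t * sqrt (2 * r)"
      using tg cp t0 by (intro mult_mono) (auto simp: v_def w_def)
    finally show ?thesis .
  qed
  ultimately show "\<bar>Im (herm z p)\<bar>
      \<le> min s (2 * r) + r * (\<delta> + 2 * r * s + 2 * t * sqrt (2 * r)) + t * sqrt (2 * r)"
    unfolding I mult.commute[of r] by linarith
qed

text \<open>The factors count the values of the \<open>m\<close> tangential coordinates, of \<open>Im \<langle>z,\<zeta>\<rangle>\<close> and of
  \<open>Im \<langle>z,p\<rangle>\<close>.  The minimum in \<open>W\<close> is needed for the bound \<open>(r/\<delta>)\<^sup>n\<close>: if \<open>s\<close> exceeds \<open>r\<close>, a cell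
  is wider than the cube.\<close>

lemma cell_count_bound:
  fixes r \<delta> \<eta> e s W :: real and k m n :: nat
  assumes r: "0 < r" "r \<le> 1/2" and \<delta>: "0 < \<delta>" "\<delta> \<le> 2 * r"
    and \<eta>: "0 < \<eta>" "\<eta> \<le> 1" and e: "0 < e" and m: "m + 2 \<le> 2 * n"
  defines "s \<equiv> \<eta> * sqrt \<delta>"
  defines "W \<equiv> min s (2 * r) + r * \<delta> + k * s * sqrt (2 * r)"
  shows "(2 * (sqrt (2 * r) / s) + 2) ^ m * (2 * (r / s) + 2) * (2 * (W / (e * \<delta>)) + 2)
    \<le> (32 / \<eta>\<^sup>2) ^ (n - 1) * (2 / e * (10 + 2 / \<eta> + 6 * k) + 4 / \<eta> + 8) * (r / \<delta>) ^ n"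
proof -
  have sq: "0 < sqrt \<delta>" "sqrt \<delta> \<le> sqrt (2 * r)" "sqrt \<delta> \<le> 1"
    using \<delta> r by auto
  have s: "0 < s" "s \<le> sqrt (2 * r)"
  proof -
    show "0 < s" using \<eta> sq(1) by (simp add: s_def)
    have "s \<le> 1 * sqrt \<delta>" unfolding s_def using \<eta> sq(1) by (intro mult_right_mono) auto
    then show "s \<le> sqrt (2 * r)" using sq(2) by linarith
  qed
  have r2: "sqrt (2 * r) * sqrt (2 * r) = 2 * r" "sqrt (2 * r) \<le> 1" using r by auto
  \<comment> \<open>As s \<le> sqrt (2 r), the additive 2 in the count is absorbed by doubling the
    quotient. Since a^2 is a multiple of r/\<delta>, the at most 2n - 2 tangential coordinates
    contribute (r/\<delta>)^(n-1).\<close>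
  define a where "a = 4 * sqrt (2 * r) / s"
  have a: "1 \<le> a" using s by (simp add: a_def le_divide_eq)
  have "2 * (sqrt (2 * r) / s) + 2 \<le> a"
    using s by (simp add: a_def field_simps)
  then have "(2 * (sqrt (2 * r) / s) + 2) ^ m \<le> a ^ m" using s r by (intro power_mono) auto
  also have "\<dots> \<le> a ^ (2 * (n - 1))" using a m by (intro power_increasing) auto
  also have "\<dots> = (32 / \<eta>\<^sup>2 * (r / \<delta>)) ^ (n - 1)"
  proof -
    have "a\<^sup>2 = 32 / \<eta>\<^sup>2 * (r / \<delta>)"
      using r \<delta> by (simp add: a_def s_def power_divide power_mult_distrib)
    then show ?thesis by (simp add: power_mult)
  qed
  finally have 1: "(2 * (sqrt (2 * r) / s) + 2) ^ m \<le> (32 / \<eta>\<^sup>2) ^ (n - 1) * (r / \<delta>) ^ (n - 1)"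
    by (simp only: power_mult_distrib)
  \<comment> \<open>The remaining two factors are estimated jointly: g W and g \<delta> are O(r), so
    their product is O(r/\<delta>). The bounds \<open>g1\<close>, \<open>g2\<close> and
    \<open>g3\<close> treat the summands of W one by one.\<close>
  define g where "g = 2 * (r / s) + 2"
  have g0: "0 < g" using r s by (simp add: g_def add_pos_pos)
  have gs: "g * s = 2 * r + 2 * s" using s by (simp add: g_def field_simps)
  have g1: "g * min s (2 * r) \<le> 6 * r"
  proof (cases "s \<le> 2 * r")
    case True then show ?thesis using gs by (simp add: min_def)
  next
    case False
    then have "r / s \<le> 1/2" using s by (simp add: field_simps)
    then have "g \<le> 3" unfolding g_def by linarith
    then have "g * (2 * r) \<le> 3 * (2 * r)" using r by (intro mult_right_mono) auto
    then show ?thesis using False by (simp add: min_def)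
  qed
  have g2: "g * \<delta> \<le> (2 / \<eta> + 4) * r"
  proof -
    have "sqrt \<delta> * sqrt \<delta> = \<delta>" using \<delta> by simp
    then have "g * \<delta> = 2 * r / \<eta> * sqrt \<delta> + 2 * \<delta>"
      using \<eta> sq by (simp add: g_def s_def field_simps)
    also have "\<dots> \<le> 2 * r / \<eta> * 1 + 2 * (2 * r)"
      using sq \<delta> r \<eta> by (intro add_mono mult_left_mono) auto
    finally show ?thesis by (simp add: algebra_simps)
  qed
  have g3: "g * (s * sqrt (2 * r)) \<le> 6 * r"
  proof -
    have "g * (s * sqrt (2 * r)) = 2 * r * sqrt (2 * r) + 2 * (s * sqrt (2 * r))"
      using gs by (simp add: algebra_simps flip: mult.assoc)
    also have "\<dots> \<le> 2 * r * 1 + 2 * (sqrt (2 * r) * sqrt (2 * r))"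
      using r2 s r by (intro add_mono mult_left_mono mult_right_mono) auto
    finally show ?thesis using r2 by simp
  qed
  have "g * (2 * W / e + 2 * \<delta>) = 2 / e * (g * W) + 2 * (g * \<delta>)" by (simp add: algebra_simps)
  also have "g * W = g * min s (2 * r) + r * (g * \<delta>) + k * (g * (s * sqrt (2 * r)))"
    by (simp add: W_def algebra_simps)
  also have "2 / e * (g * min s (2 * r) + r * (g * \<delta>) + k * (g * (s * sqrt (2 * r)))) + 2 * (g * \<delta>)
      \<le> 2 / e * (6 * r + 1 * ((2 / \<eta> + 4) * r) + k * (6 * r)) + 2 * ((2 / \<eta> + 4) * r)"
  proof -
    have "r * (g * \<delta>) \<le> 1 * ((2 / \<eta> + 4) * r)" using g0 r \<delta> by (intro mult_mono[OF _ g2]) auto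
    then show ?thesis using e by (intro g1 g2 g3 add_mono mult_left_mono) auto
  qed
  also have "\<dots> = (2 / e * (10 + 2 / \<eta> + 6 * k) + 4 / \<eta> + 8) * r"
    by (simp add: algebra_simps)
  finally have "g * (2 * W / e + 2 * \<delta>) / \<delta> \<le> (2 / e * (10 + 2 / \<eta> + 6 * k) + 4 / \<eta> + 8) * r / \<delta>"
    using \<delta> by (intro divide_right_mono) auto
  moreover have "g * (2 * (W / (e * \<delta>)) + 2) = g * (2 * W / e + 2 * \<delta>) / \<delta>"
    using \<delta> e by (simp add: field_simps)
  ultimately have 2: "g * (2 * (W / (e * \<delta>)) + 2) \<le> (2 / e * (10 + 2 / \<eta> + 6 * k) + 4 / \<eta> + 8) * (r / \<delta>)"
    by simp
  have W0: "0 \<le> W" using s r \<delta> by (simp add: W_def)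
  have "(2 * (sqrt (2 * r) / s) + 2) ^ m * (g * (2 * (W / (e * \<delta>)) + 2))
      \<le> ((32 / \<eta>\<^sup>2) ^ (n - 1) * (r / \<delta>) ^ (n - 1)) *
        ((2 / e * (10 + 2 / \<eta> + 6 * k) + 4 / \<eta> + 8) * (r / \<delta>))"
    using g0 W0 e \<delta> r by (intro mult_mono[OF 1 2]) auto
  also have "\<dots> = (32 / \<eta>\<^sup>2) ^ (n - 1) * (2 / e * (10 + 2 / \<eta> + 6 * k) + 4 / \<eta> + 8) *
      ((r / \<delta>) ^ (n - 1) * (r / \<delta>))" by (simp only: mult_ac)
  also have "(r / \<delta>) ^ (n - 1) * (r / \<delta>) = (r / \<delta>) ^ n"
    using m by (cases n) auto
  finally show ?thesis by (simp add: g_def mult.assoc)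
qed

section \<open>Covering one layer\<close>

definition carleson_layer ::
    "complex ^ 'n \<Rightarrow> real \<Rightarrow> real \<Rightarrow> real \<Rightarrow> (complex ^ 'n) set"
  where "carleson_layer \<zeta> r q \<delta> =
    {z \<in> carleson_cube \<zeta> r. q * \<delta> < 1 - (norm z)\<^sup>2 \<and> 1 - (norm z)\<^sup>2 \<le> \<delta>}"

text \<open>The cells are cut out in two steps: first a grid of mesh \<open>s\<close> in the tangential coordinates and
  in \<open>Im \<langle>z,\<zeta>\<rangle>\<close>, then, with \<open>p\<close> a point of the cell so obtained, a grid of mesh \<open>e \<delta>\<close> in
  \<open>Im \<langle>z,p\<rangle>\<close>.  The coordinate \<open>Re \<langle>z,\<zeta>\<rangle>\<close> needs no grid because the layer is thin.\<close>

lemma carleson_layer_cover: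
  assumes R: "R > 0" and q: "0 < q" and e: "0 < e" "e \<le> 1"
    and qe: "(1 - (tanh R)\<^sup>2) * (1 + 12 * e\<^sup>2) < q\<^sup>2"
  shows "\<exists>C > 0. \<forall>(\<zeta> :: complex ^ 'n) r \<delta>. norm \<zeta> = 1 \<longrightarrow> 0 < r \<longrightarrow> r \<le> e\<^sup>2 / 8 \<longrightarrow> 0 < \<delta> \<longrightarrow> \<delta> \<le> 2 * r \<longrightarrow>
    (\<exists>F. finite F \<and> F \<subseteq> carleson_layer \<zeta> r q \<delta> \<and>
      real (card F) \<le> C * (r / \<delta>) ^ CARD('n) \<and>
      carleson_layer \<zeta> r q \<delta> \<subseteq> (\<Union>w\<in>F. bergman_ball w R))"
proof -
  define n where "n = CARD('n)"
  \<comment> \<open>k dominates 3 m + 2 for m = card B, the coefficient of s in the distance bound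
    of \<open>cell_bounds\<close>. Then \<eta> makes k s equal to half of e sqrt \<delta>, and r
    \<le> e^2 / 8 makes the remaining term \<delta> at most the other half.\<close>
  define k where "k = 6 * n + 2"
  define \<eta> where "\<eta> = e / (2 * k)"
  have k: "real k \<ge> 1" by (simp add: k_def)
  have \<eta>: "0 < \<eta>" "\<eta> \<le> 1" using e k by (auto simp: \<eta>_def field_simps)
  define C where "C = (32 / \<eta>\<^sup>2) ^ (n - 1) * (2 / e * (10 + 2 / \<eta> + 6 * k) + 4 / \<eta> + 8)"
  show ?thesis
  proof (intro exI[of _ C] conjI allI impI)
    show "0 < C" using \<eta> e by (auto simp: C_def intro!: mult_pos_pos add_pos_nonneg add_nonneg_pos)
  next
    fix \<zeta> :: "complex ^ 'n" and r \<delta>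
    assume \<zeta>: "norm \<zeta> = 1" and r: "0 < r" "r \<le> e\<^sup>2 / 8" and \<delta>: "0 < \<delta>" "\<delta> \<le> 2 * r"
    have "e\<^sup>2 \<le> 1" using e by (simp add: power_le_one)
    then have r8: "r \<le> 1/8" "r \<le> 1/2" using r by auto
    define A where "A = carleson_layer \<zeta> r q \<delta>"
    have A: "z \<in> carleson_cube \<zeta> r" "q * \<delta> < 1 - (norm z)\<^sup>2" "1 - (norm z)\<^sup>2 \<le> \<delta>" if "z \<in> A" for z
      using that by (auto simp: A_def carleson_layer_def)
    obtain B where B: "finite B" "card B + 2 \<le> 2 * CARD('n)" "\<And>b. b \<in> B \<Longrightarrow> norm b = 1"
      "\<And>v. herm v \<zeta> = 0 \<Longrightarrow> norm v \<le> (\<Sum>b\<in>B. \<bar>v \<bullet> b\<bar>)"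
      using tangent_space_basis[OF \<zeta>] by blast
    define s where "s = \<eta> * sqrt \<delta>"
    have s: "0 < s" using \<eta> \<delta> by (simp add: s_def)
    define W where "W = min s (2 * r) + r * \<delta> + k * s * sqrt (2 * r)"
    have W: "0 \<le> W" using s r \<delta> by (simp add: W_def)
    define key1 where "key1 z = ((\<lambda>b\<in>B. \<lfloor>(tangential \<zeta> z \<bullet> b) / s\<rfloor>), \<lfloor>Im (herm z \<zeta>) / s\<rfloor>)" for z
    \<comment> \<open>The representative depends on z only through \<open>key1 z\<close>. Points
      with equal full key hence share it, and their second entries measure the imaginary part
      against the same point.\<close>
    define rep where "rep z = inv_into A key1 (key1 z)" for z
    define key where "key z = (key1 z, \<lfloor>Im (herm z (rep z)) / (e * \<delta>)\<rfloor>)" for z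
    define J where "J c = {\<lfloor>- c\<rfloor>..\<lfloor>c\<rfloor>}" for c :: real
    define K where "K = ((\<Pi>\<^sub>E b\<in>B. J (sqrt (2 * r) / s)) \<times> J (r / s)) \<times> J (W / (e * \<delta>))"
    have rep: "rep z \<in> A" "key1 (rep z) = key1 z" if "z \<in> A" for z
      using that by (auto simp: rep_def intro!: inv_into_into f_inv_into_f)
    have mk: "3 * real (card B) + 2 \<le> k" using B(2) by (simp add: k_def n_def)
    have sqr: "sqrt (2 * r) \<le> e / 2" "2 * r \<le> sqrt (2 * r)" "sqrt (2 * r) \<le> 1"
    proof -
      show "sqrt (2 * r) \<le> e / 2" using r e by (intro real_le_lsqrt) (auto simp: power_divide)
      then show "sqrt (2 * r) \<le> 1" using e by linarith
      then have "sqrt (2 * r) * sqrt (2 * r) \<le> 1 * sqrt (2 * r)" using r by (intro mult_right_mono) auto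
      then show "2 * r \<le> sqrt (2 * r)" using r by simp
    qed
    have cell: "norm (z - p) \<le> e * sqrt \<delta>" "\<bar>Im (herm z p)\<bar> \<le> W"
      if z: "z \<in> A" and p: "p \<in> A" and eq: "key1 z = key1 p" for z p
    proof -
      define t where "t = card B * s"
      have "\<lfloor>(tangential \<zeta> z \<bullet> b) / s\<rfloor> = \<lfloor>(tangential \<zeta> p \<bullet> b) / s\<rfloor>" if "b \<in> B" for b
        using arg_cong[OF eq, of "\<lambda>k. fst k b"] that by (simp add: key1_def)
      then have "\<bar>tangential \<zeta> z \<bullet> b - tangential \<zeta> p \<bullet> b\<bar> \<le> s" if "b \<in> B" for b
        using that s by (intro abs_diff_le_of_floor_eq)
      then have "(\<Sum>b\<in>B. \<bar>(tangential \<zeta> z - tangential \<zeta> p) \<bullet> b\<bar>) \<le> t"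
        unfolding t_def by (intro sum_bounded_above) (simp add: inner_diff_left)
      moreover have "herm (tangential \<zeta> z - tangential \<zeta> p) \<zeta> = 0"
        by (simp add: herm_linear herm_tangential(1)[OF \<zeta>])
      ultimately have tg: "norm (tangential \<zeta> z - tangential \<zeta> p) \<le> t"
        using B(4) order_trans by blast
      have im: "\<bar>Im (herm z \<zeta>) - Im (herm p \<zeta>)\<bar> \<le> s"
        using eq s by (intro abs_diff_le_of_floor_eq) (auto simp: key1_def)
      have "0 < q * \<delta>" using q \<delta> by simp
      then have d: "\<bar>(norm z)\<^sup>2 - (norm p)\<^sup>2\<bar> \<le> \<delta>" using A[OF z] A[OF p] by linarith
      note cb = cell_bounds[OF \<zeta> r(1) r8(2) A(1)[OF z] A(1)[OF p] d im tg]
      have t0: "0 \<le> t" using s by (simp add: t_def)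
      have b1: "2 * r * s \<le> 1 * s" "2 * t * sqrt (2 * r) \<le> 2 * t * 1"
        using mult_right_mono[of "2 * r" 1 s] mult_left_mono[of "sqrt (2 * r)" 1 "2 * t"] r8 s t0 sqr
        by simp_all
      have b2: "s + s + 2 * t + t \<le> k * s"
        using mult_right_mono[OF mk, of s] s by (simp add: t_def algebra_simps)
      have b3: "\<delta> \<le> e / 2 * sqrt \<delta>"
      proof -
        have "sqrt \<delta> \<le> e / 2" using sqr(1) real_sqrt_le_mono[OF \<delta>(2)] by linarith
        then have "sqrt \<delta> * sqrt \<delta> \<le> e / 2 * sqrt \<delta>"
          using \<delta> by (intro mult_right_mono) auto
        then show ?thesis using \<delta> by simp
      qed
      have b4: "k * s = e / 2 * sqrt \<delta>" using k by (simp add: s_def \<eta>_def)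
      show "norm (z - p) \<le> e * sqrt \<delta>" using cb(1) b1 b2 b3 b4 by linarith
      have "r * (\<delta> + 2 * r * s + 2 * t * sqrt (2 * r)) + t * sqrt (2 * r)
          = r * \<delta> + r * s * (2 * r) + (2 * r) * (t * sqrt (2 * r)) + t * sqrt (2 * r)"
        by (simp add: algebra_simps)
      also have "\<dots> \<le> r * \<delta> + 1 * s * sqrt (2 * r) + 1 * (t * sqrt (2 * r)) + t * sqrt (2 * r)"
        using r8 r s t0 sqr \<delta> by (intro add_mono mult_mono) auto
      also have "\<dots> = r * \<delta> + (s + 2 * t) * sqrt (2 * r)" by (simp add: algebra_simps)
      also have "\<dots> \<le> r * \<delta> + (k * s) * sqrt (2 * r)"
        using b2 s t0 r \<delta> by (intro add_mono mult_right_mono) auto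
      finally show "\<bar>Im (herm z p)\<bar> \<le> W" using cb(2) by (simp add: W_def)
    qed
    have finJ: "finite (J c)" for c by (simp add: J_def)
    have "finite K" unfolding K_def by (intro finite_cartesian_product finite_PiE B(1) finJ)
    moreover have "key ` A \<subseteq> K"
    proof (intro image_subsetI)
      fix z assume z: "z \<in> A"
      note cz = carleson_cube_coords[OF \<zeta> r8(2) A(1)[OF z]]
      have "\<bar>tangential \<zeta> z \<bullet> b\<bar> \<le> sqrt (2 * r)" if "b \<in> B" for b
        using Cauchy_Schwarz_ineq2[of "tangential \<zeta> z" b] B(3)[OF that] cz(4) by simp
      then have "\<bar>(tangential \<zeta> z \<bullet> b) / s\<bar> \<le> sqrt (2 * r) / s" if "b \<in> B" for b
        using that s by (simp add: abs_divide divide_right_mono)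
      moreover have "\<bar>Im (herm z \<zeta>) / s\<bar> \<le> r / s" using cz s by (simp add: abs_divide divide_right_mono)
      moreover have "\<bar>Im (herm z (rep z)) / (e * \<delta>)\<bar> \<le> W / (e * \<delta>)"
        using cell(2)[OF z rep(1)[OF z]] rep(2)[OF z] e \<delta> by (simp add: abs_divide abs_mult divide_right_mono)
      ultimately show "key z \<in> K"
        unfolding key_def key1_def K_def J_def
        by (intro SigmaI restrict_PiE_iff[THEN iffD2] ballI floor_mem_interval) auto
    qed
    moreover have "w \<in> bergman_ball z R" if z: "z \<in> A" and w: "w \<in> A" and eq: "key z = key w" for z w
    proof -
      have k1: "key1 z = key1 w" using eq by (simp add: key_def)
      then have rw: "rep w = rep z" by (simp add: rep_def)
      have "\<bar>Im (herm z (rep z)) - Im (herm w (rep z))\<bar> \<le> e * \<delta>"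
        using eq rw e \<delta> by (intro abs_diff_le_of_floor_eq) (auto simp: key_def)
      moreover have "norm (z - rep z) \<le> e * sqrt \<delta>" "norm (w - rep z) \<le> e * sqrt \<delta>"
        using cell(1) rep z w k1 by auto
      ultimately show ?thesis
        using A[OF z] A[OF w] carleson_cube_coords(6)[OF \<zeta> r8(2)]
        by (intro mem_bergman_ball_of_near[OF R _ _ \<delta>(1) e q qe]) auto
    qed
    ultimately obtain F where F: "finite F" "F \<subseteq> A" "card F \<le> card K" "A \<subseteq> (\<Union>w\<in>F. bergman_ball w R)"
      using finite_net_of_key[of K key A "\<lambda>z. bergman_ball z R"] by blast
    have "real (card K) = real (card (J (sqrt (2 * r) / s))) ^ card B * real (card (J (r / s)))
        * real (card (J (W / (e * \<delta>))))"
      using B(1) by (simp add: K_def card_cartesian_product card_PiE)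
    also have "\<dots> \<le> (2 * (sqrt (2 * r) / s) + 2) ^ card B * (2 * (r / s) + 2) * (2 * (W / (e * \<delta>)) + 2)"
      using s r e \<delta> W unfolding J_def
      by (intro mult_mono power_mono card_floor_interval) auto
    also have "\<dots> \<le> C * (r / \<delta>) ^ n"
      unfolding C_def W_def s_def using r r8 \<delta> \<eta> e B(2) by (intro cell_count_bound) (auto simp: n_def)
    finally have "real (card F) \<le> C * (r / \<delta>) ^ n" using F(3) by linarith
    then show "\<exists>F. finite F \<and> F \<subseteq> carleson_layer \<zeta> r q \<delta> \<and>
      real (card F) \<le> C * (r / \<delta>) ^ CARD('n) \<and>
      carleson_layer \<zeta> r q \<delta> \<subseteq> (\<Union>w\<in>F. bergman_ball w R)"
      using F unfolding A_def n_def by blast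
  qed
qed

section \<open>Carleson measures\<close>

lemma divide_ennreal_le_iff:
  assumes "0 < x"
  shows "a / ennreal x \<le> b \<longleftrightarrow> a \<le> b * ennreal x"
proof
  assume "a / ennreal x \<le> b"
  then have "a / ennreal x * ennreal x \<le> b * ennreal x" by (rule mult_right_mono) simp
  moreover have "a / ennreal x * ennreal x = a"
    using assms by (simp add: ennreal_divide_times ennreal_mult_divide_eq)
  ultimately show "a \<le> b * ennreal x" by simp
next
  assume "a \<le> b * ennreal x"
  then have "a / ennreal x \<le> b * ennreal x / ennreal x" by (rule divide_right_mono_ennreal)
  also have "\<dots> = b" using assms by (simp add: ennreal_mult_divide_eq)
  finally show "a / ennreal x \<le> b" .
qed

text \<open>A rotation by a fourth root of unity brings w = x + \<i> y into the sector |y| \<le> x,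
  where |1 - w|^2 \<le> 1 - 2 x + 2 x^2 < 1.\<close>

lemma exists_unit_near:
  fixes w :: complex
  assumes "w \<noteq> 0" "cmod w < 1"
  shows "\<exists>u\<in>{1, -1, \<i>, -\<i>}. cmod (1 - w * cnj u) < 1"
proof -
  define a b where "a = Re w" and "b = Im w"
  have w: "w = Complex a b" by (simp add: a_def b_def)
  have ab: "\<bar>a\<bar> < 1" "\<bar>b\<bar> < 1"
    using assms(2) abs_Re_le_cmod[of w] abs_Im_le_cmod[of w] by (auto simp: a_def b_def)
  have ne: "a \<noteq> 0 \<or> b \<noteq> 0" using assms(1) by (auto simp: w complex_eq_iff)
  have key: "sqrt ((1 - x)\<^sup>2 + y\<^sup>2) < 1" if "0 < x" "x < 1" "\<bar>y\<bar> \<le> x" for x y :: real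
  proof -
    have "y\<^sup>2 \<le> x\<^sup>2" using that by (metis abs_ge_zero power2_abs power_mono)
    moreover have "x\<^sup>2 < x" using that by (simp add: power2_eq_square)
    ultimately have "(1 - x)\<^sup>2 + y\<^sup>2 < 1" by (simp add: power2_diff)
    then show ?thesis by simp
  qed
  consider "0 < a" "\<bar>b\<bar> \<le> a" | "0 < - a" "\<bar>b\<bar> \<le> - a" | "0 < b" "\<bar>a\<bar> \<le> b" | "0 < - b" "\<bar>a\<bar> \<le> - b"
    using ne by linarith
  then show ?thesis
  proof cases
    case 1 then show ?thesis using key[of a b] ab by (simp add: w cmod_def)
  next
    case 2 then show ?thesis using key[of "- a" b] ab by (simp add: w cmod_def)
  next
    case 3 then show ?thesis using key[of b a] ab by (simp add: w cmod_def)
  next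
    case 4 then show ?thesis using key[of "- b" a] ab by (simp add: w cmod_def)
  qed
qed

text \<open>The square of q is the midpoint of \<kappa> and 1, and 12 e^2 = (1 - \<kappa>)/4 uses up
  less than the gap (1 - \<kappa>)/2 between \<kappa> and q^2.\<close>

lemma exists_net_parameters:
  fixes \<kappa> :: real
  assumes "0 < \<kappa>" "\<kappa> < 1"
  shows "\<exists>q e. 0 < q \<and> q < 1 \<and> 0 < e \<and> e \<le> 1 \<and> \<kappa> * (1 + 12 * e\<^sup>2) < q\<^sup>2"
proof (intro exI conjI)
  let ?q = "sqrt ((1 + \<kappa>) / 2)" and ?e = "sqrt ((1 - \<kappa>) / 48)"
  show "0 < ?q" "?q < 1" "0 < ?e" "?e \<le> 1" using assms by auto
  have "\<kappa> * (1 - \<kappa>) < 1 * (1 - \<kappa>)" using assms by (intro mult_strict_right_mono) auto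
  then show "\<kappa> * (1 + 12 * ?e\<^sup>2) < ?q\<^sup>2" using assms by (simp add: field_simps)
qed

section \<open>Comparison of the two ratios for a fixed measure\<close>

context
  fixes \<gamma> :: real and \<mu> :: "(complex ^ 'n) measure"
  assumes \<gamma>: "\<gamma> > 1" and sets_\<mu>: "sets \<mu> = sets (restrict_space borel (ball 0 1))"
begin

lemma open_in_sets: "open U \<Longrightarrow> U \<subseteq> ball 0 1 \<Longrightarrow> U \<in> sets \<mu>"
  unfolding sets_\<mu> by (auto simp: sets_restrict_space_iff)

lemma space_eq_ball: "space \<mu> = ball 0 1"
  using sets_eq_imp_space_eq[OF sets_\<mu>] by (simp add: space_restrict_space)

lemma bergman_ball_in_sets: "R > 0 \<Longrightarrow> norm a < 1 \<Longrightarrow> bergman_ball a R \<in> sets \<mu>"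
  by (intro open_in_sets open_bergman_ball) (auto simp: bergman_ball_def)

lemma carleson_cube_in_sets: "carleson_cube \<zeta> r \<in> sets \<mu>"
  by (intro open_in_sets open_carleson_cube) (auto simp: carleson_cube_def)

lemma bergman_ratio_le_iff:
  "norm a < 1 \<Longrightarrow> bergman_ratio \<gamma> \<mu> R a \<le> M \<longleftrightarrow>
    emeasure \<mu> (bergman_ball a R) \<le> M * ennreal ((1 - (norm a)\<^sup>2) powr (real CARD('n) * \<gamma>))"
  unfolding bergman_ratio_def using one_minus_norm_sq_bounds(1)[of a]
  by (intro divide_ennreal_le_iff) simp

lemma carleson_ratio_le_iff:
  "0 < r \<Longrightarrow> carleson_ratio \<gamma> \<mu> \<zeta> r \<le> M \<longleftrightarrow>
    emeasure \<mu> (carleson_cube \<zeta> r) \<le> M * ennreal (r powr (real CARD('n) * \<gamma>))"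
  unfolding carleson_ratio_def by (intro divide_ennreal_le_iff) simp

text \<open>C and \<open>r\<^sub>0\<close> are chosen before M, and M has to bound the ratio only at
  depths below 2 r. With M the global supremum this gives boundedness, with M small and r near 0 it
  gives vanishing.\<close>

lemma carleson_ratio_le_of_bergman_ratio_le:
  assumes R: "R > 0"
  shows "\<exists>C>0. \<exists>r\<^sub>0>0. \<forall>\<zeta> r M. norm \<zeta> = 1 \<longrightarrow> 0 < r \<longrightarrow> r \<le> r\<^sub>0 \<longrightarrow>
    (\<forall>a. norm a < 1 \<longrightarrow> 1 - (norm a)\<^sup>2 < 2 * r \<longrightarrow> bergman_ratio \<gamma> \<mu> R a \<le> M) \<longrightarrow>
    carleson_ratio \<gamma> \<mu> \<zeta> r \<le> ennreal C * M"
proof -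
  define n where "n = CARD('n)"
  define N where "N = real n * \<gamma>"
  have n: "0 < n" by (simp add: n_def)
  obtain q e where q: "0 < q" "q < 1" and e: "0 < e" "e \<le> 1"
    and qe: "(1 - (tanh R)\<^sup>2) * (1 + 12 * e\<^sup>2) < q\<^sup>2"
    using exists_net_parameters[OF tanh_sq_bounds[OF R]] by blast
  obtain C0 where C0: "0 < C0" and cover: "\<And>(\<zeta> :: complex ^ 'n) r \<delta>.
      norm \<zeta> = 1 \<Longrightarrow> 0 < r \<Longrightarrow> r \<le> e\<^sup>2 / 8 \<Longrightarrow> 0 < \<delta> \<Longrightarrow> \<delta> \<le> 2 * r \<Longrightarrow>
      \<exists>F. finite F \<and> F \<subseteq> carleson_layer \<zeta> r q \<delta> \<and>
      real (card F) \<le> C0 * (r / \<delta>) ^ n \<and>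
      carleson_layer \<zeta> r q \<delta> \<subseteq> (\<Union>w\<in>F. bergman_ball w R)"
    using carleson_layer_cover[OF R q(1) e qe] unfolding n_def by blast
  \<comment> \<open>Ratio of the geometric series: from one layer to the next the number of balls
    grows by q^(-n) and the bound for each ball shrinks by q^(n\<gamma>). It is below 1 because
    n\<gamma> - n > 0.\<close>
  define x where "x = q powr N / q ^ n"
  have x: "0 \<le> x" "x < 1"
  proof -
    have "x = q powr (N - n)" using q by (simp add: x_def powr_diff powr_realpow)
    moreover have "0 < N - n" using \<gamma> n by (simp add: N_def)
    ultimately show "0 \<le> x" "x < 1" using q powr_less_mono2[of "N - n" q 1] by auto
  qed
  define C where "C = C0 / 2 ^ n * 2 powr N / (1 - x)"
  have C: "0 < C" using C0 x by (simp add: C_def)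
  show ?thesis
  proof (rule exI[of _ C], rule conjI[OF C], rule exI[of _ "e\<^sup>2 / 8"], intro conjI allI impI)
    show "0 < e\<^sup>2 / 8" using e by simp
    fix \<zeta> :: "complex ^ 'n" and r M
    assume \<zeta>: "norm \<zeta> = 1" and r: "0 < r" "r \<le> e\<^sup>2 / 8"
      and M: "\<forall>a. norm a < 1 \<longrightarrow> 1 - (norm a)\<^sup>2 < 2 * r \<longrightarrow> bergman_ratio \<gamma> \<mu> R a \<le> M"
    have "e\<^sup>2 \<le> 1" using e by (simp add: power_le_one)
    then have r8: "r \<le> 1/2" using r by auto
    \<comment> \<open>The sequence starts at 2 r because every point of the cube has depth below 2
      r.\<close>
    define \<delta> where "\<delta> k = 2 * r * q ^ k" for k :: nat
    have \<delta>: "0 < \<delta> k" "\<delta> k \<le> 2 * r" for k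
      using r q by (auto simp: \<delta>_def power_le_one mult_left_le)
    define A where "A k = carleson_layer \<zeta> r q (\<delta> k)" for k
    have "\<forall>k. \<exists>F. finite F \<and> F \<subseteq> A k \<and> real (card F) \<le> C0 * (r / \<delta> k) ^ n \<and>
        A k \<subseteq> (\<Union>w\<in>F. bergman_ball w R)"
      unfolding A_def using cover[OF \<zeta> r \<delta>] by blast
    then obtain F where F: "\<And>k. finite (F k)" "\<And>k. F k \<subseteq> A k"
        "\<And>k. real (card (F k)) \<le> C0 * (r / \<delta> k) ^ n"
        "\<And>k. A k \<subseteq> (\<Union>w\<in>F k. bergman_ball w R)"
      by metis
    define U where "U k = (\<Union>w\<in>F k. bergman_ball w R)" for k
    have Fball: "norm w < 1" if "w \<in> F k" for w k
      using that F(2)[of k] by (auto simp: A_def carleson_layer_def carleson_cube_def)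
    have U_sets: "U k \<in> sets \<mu>" for k
      unfolding U_def using F(1) Fball by (intro sets.finite_UN bergman_ball_in_sets[OF R]) auto
    have sub: "carleson_cube \<zeta> r \<subseteq> (\<Union>k. U k)"
    proof
      fix z assume z: "z \<in> carleson_cube \<zeta> r"
      note cz = carleson_cube_coords[OF \<zeta> r8 z]
      have "0 < 1 - (norm z)\<^sup>2" using one_minus_norm_sq_bounds(1)[of z] cz by simp
      then obtain j where "q ^ j < (1 - (norm z)\<^sup>2) / (2 * r)"
        using real_arch_pow_inv[of "(1 - (norm z)\<^sup>2) / (2 * r)" q] q r by auto
      then have j: "\<delta> j < 1 - (norm z)\<^sup>2" using r by (simp add: \<delta>_def field_simps)
      define l where "l = (LEAST j. \<delta> j < 1 - (norm z)\<^sup>2)"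
      have l: "\<delta> l < 1 - (norm z)\<^sup>2" unfolding l_def using j by (rule LeastI)
      \<comment> \<open>The depth is below \<delta> 0, so the first index whose \<delta> lies below
        the depth has a predecessor, and that predecessor numbers the layer of z.\<close>
      have "l \<noteq> 0" using l cz by (auto simp: \<delta>_def intro: ccontr)
      then obtain k where k: "l = Suc k" by (cases l) auto
      then have "\<not> \<delta> k < 1 - (norm z)\<^sup>2" unfolding l_def by (intro not_less_Least) simp
      moreover have "q * \<delta> k = \<delta> l" by (simp add: \<delta>_def k)
      ultimately have "z \<in> A k" using l z by (simp add: A_def carleson_layer_def)
      then have "z \<in> U k" using F(4)[of k] unfolding U_def by blast
      then show "z \<in> (\<Union>k. U k)" by blast
    qed
    have Uk: "emeasure \<mu> (U k) \<le> M * ennreal (C0 / 2 ^ n * (2 * r) powr N * x ^ k)" for k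
    proof -
      have "emeasure \<mu> (U k) \<le> (\<Sum>w\<in>F k. emeasure \<mu> (bergman_ball w R))"
        unfolding U_def using F(1) Fball by (intro emeasure_subadditive_finite) (auto intro: bergman_ball_in_sets R)
      also have "\<dots> \<le> (\<Sum>w\<in>F k. M * ennreal (\<delta> k powr N))"
      proof (rule sum_mono)
        fix w assume w: "w \<in> F k"
        then have wA: "w \<in> carleson_cube \<zeta> r" "1 - (norm w)\<^sup>2 \<le> \<delta> k" using F(2)[of k] by (auto simp: A_def carleson_layer_def)
        note cw = carleson_cube_coords[OF \<zeta> r8 wA(1)]
        have "bergman_ratio \<gamma> \<mu> R w \<le> M" using M cw by blast
        then have "emeasure \<mu> (bergman_ball w R) \<le> M * ennreal ((1 - (norm w)\<^sup>2) powr N)"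
          using bergman_ratio_le_iff[OF cw(6)] by (simp add: N_def n_def)
        also have "\<dots> \<le> M * ennreal (\<delta> k powr N)"
          using one_minus_norm_sq_bounds(1)[of w] cw(6) wA(2) n \<gamma>
          by (intro mult_left_mono ennreal_leI powr_mono2) (auto simp: N_def)
        finally show "emeasure \<mu> (bergman_ball w R) \<le> M * ennreal (\<delta> k powr N)" .
      qed
      also have "\<dots> = M * (ennreal (real (card (F k))) * ennreal (\<delta> k powr N))"
        by (simp add: ennreal_of_nat_eq_real_of_nat mult_ac)
      also have "\<dots> \<le> M * (ennreal (C0 * (r / \<delta> k) ^ n) * ennreal (\<delta> k powr N))"
        using F(3) by (intro mult_left_mono mult_right_mono ennreal_leI) auto
      also have "\<dots> = M * ennreal (C0 * (r / \<delta> k) ^ n * \<delta> k powr N)"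
        using C0 r \<delta>(1)[of k] by (simp add: ennreal_mult)
      also have "C0 * (r / \<delta> k) ^ n * \<delta> k powr N = C0 / 2 ^ n * (2 * r) powr N * x ^ k"
      proof -
        have "(r / \<delta> k) ^ n = 1 / 2 ^ n * (1 / (q ^ n) ^ k)"
          using r q by (simp add: \<delta>_def power_divide power_mult_distrib flip: power_mult)
            (simp add: mult.commute)
        moreover have "\<delta> k powr N = (2 * r) powr N * (q powr N) ^ k"
          using r q by (simp add: \<delta>_def powr_mult powr_powr mult.commute flip: powr_realpow)
        ultimately show ?thesis by (simp add: x_def power_divide)
      qed
      finally show ?thesis .
    qed
    have "emeasure \<mu> (carleson_cube \<zeta> r) \<le> emeasure \<mu> (\<Union>k. U k)"
      using sub U_sets by (intro emeasure_mono) auto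
    also have "\<dots> \<le> (\<Sum>k. emeasure \<mu> (U k))"
      using U_sets by (intro emeasure_subadditive_countably) auto
    also have "\<dots> \<le> (\<Sum>k. M * ennreal (C0 / 2 ^ n * (2 * r) powr N * x ^ k))"
      using Uk by (intro suminf_le) auto
    also have "\<dots> = M * ennreal (\<Sum>k. C0 / 2 ^ n * (2 * r) powr N * x ^ k)"
      using x C0 by (subst ennreal_suminf_cmult, subst suminf_ennreal2)
        (auto intro!: summable_mult summable_geometric)
    also have "(\<Sum>k. C0 / 2 ^ n * (2 * r) powr N * x ^ k) = C * r powr N"
    proof -
      have "(\<Sum>k. C0 / 2 ^ n * (2 * r) powr N * x ^ k) = C0 / 2 ^ n * (2 * r) powr N * (1 / (1 - x))"
        using x by (subst suminf_mult) (auto simp: suminf_geometric intro: summable_geometric)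
      then show ?thesis using r by (simp add: C_def powr_mult)
    qed
    also have "M * ennreal (C * r powr N) = ennreal C * M * ennreal (r powr N)"
      using C by (simp add: ennreal_mult mult_ac)
    finally show "carleson_ratio \<gamma> \<mu> \<zeta> r \<le> ennreal C * M"
      using r by (simp add: carleson_ratio_le_iff N_def n_def)
  qed
qed

text \<open>The cube has size C (1 - |a|^2), so the two denominators differ by the power of C. This
  size may reach 1 or more when a is far from the sphere; such centres must be excluded or treated
  separately when the bound is applied.\<close>

lemma bergman_ratio_le_carleson_ratio:
  assumes R: "R > 0" and a: "norm a < 1" "a \<noteq> 0"
  defines "C \<equiv> 2 / (1 - (tanh R)\<^sup>2) + 1"
  shows "bergman_ratio \<gamma> \<mu> R a \<le> ennreal (C powr (real CARD('n) * \<gamma>)) *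
    carleson_ratio \<gamma> \<mu> ((1 / norm a) *\<^sub>R a) (C * (1 - (norm a)\<^sup>2))"
proof -
  have C: "0 < C" using tanh_sq_bounds[OF R] by (simp add: C_def add_pos_pos)
  define h where "h = 1 - (norm a)\<^sup>2"
  have h: "0 < h" using one_minus_norm_sq_bounds(1)[of a] a by (simp add: h_def)
  let ?Q = "carleson_cube ((1 / norm a) *\<^sub>R a) (C * h)" and ?N = "real CARD('n) * \<gamma>"
  have "emeasure \<mu> (bergman_ball a R) \<le> emeasure \<mu> ?Q"
    using bergman_ball_subset_carleson_cube[OF R a]
    by (intro emeasure_mono carleson_cube_in_sets) (simp add: C_def h_def)
  also have "\<dots> \<le> carleson_ratio \<gamma> \<mu> ((1 / norm a) *\<^sub>R a) (C * h) * ennreal ((C * h) powr ?N)"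
    using C h by (intro iffD1[OF carleson_ratio_le_iff order_refl]) simp
  also have "ennreal ((C * h) powr ?N) = ennreal (C powr ?N) * ennreal (h powr ?N)"
    using C h by (simp add: powr_mult ennreal_mult)
  finally show ?thesis
    using a by (simp add: bergman_ratio_le_iff h_def mult_ac)
qed

section \<open>Finiteness of the total mass\<close>

lemma emeasure_ball_finite_of_cover:
  assumes "finite \<C>" "ball 0 1 \<subseteq> \<Union>\<C>" "\<And>X. X \<in> \<C> \<Longrightarrow> X \<in> sets \<mu> \<and> emeasure \<mu> X < \<infinity>"
  shows "emeasure \<mu> (ball 0 1) < \<infinity>"
proof -
  have "emeasure \<mu> (ball 0 1) \<le> emeasure \<mu> (\<Union>X\<in>\<C>. X)"
    using assms by (intro emeasure_mono) auto
  also have "\<dots> \<le> (\<Sum>X\<in>\<C>. emeasure \<mu> X)"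
    using assms by (intro emeasure_subadditive_finite) auto
  also have "\<dots> < \<infinity>" using assms by (simp add: less_top)
  finally show ?thesis .
qed

text \<open>The cubes of size \<open>1\<close> about \<open>u e\<^sub>j\<close>, \<open>u \<in> {1, -1, \<i>, -\<i>}\<close>, cover the punctured ball.\<close>

lemma emeasure_ball_finite_of_carleson_bounded:
  assumes fin: "emeasure \<mu> {0} < \<infinity>" and cb: "carleson_bounded \<gamma> \<mu>"
  shows "emeasure \<mu> (ball 0 1) < \<infinity>"
proof -
  let ?N = "real CARD('n) * \<gamma>"
  define M where "M = (SUP (\<zeta>, r)\<in>sphere 0 1 \<times> {0<..<1}. carleson_ratio \<gamma> \<mu> \<zeta> r)"
  have M: "M < \<infinity>" using cb by (simp add: carleson_bounded_def M_def)
  have less1: "emeasure \<mu> (carleson_cube \<zeta> r) \<le> M" if "norm \<zeta> = 1" "0 < r" "r < 1" for \<zeta> r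
  proof -
    have "carleson_ratio \<gamma> \<mu> \<zeta> r \<le> M"
      unfolding M_def using that by (intro SUP_upper2[of "(\<zeta>, r)"]) auto
    then have "emeasure \<mu> (carleson_cube \<zeta> r) \<le> M * ennreal (r powr ?N)"
      using that by (simp add: carleson_ratio_le_iff)
    also have "\<dots> \<le> M * 1"
      using that \<gamma> by (intro mult_left_mono) (auto simp: powr_le1)
    finally show ?thesis by simp
  qed
  have cube1: "emeasure \<mu> (carleson_cube \<zeta> 1) \<le> M" if \<zeta>: "norm \<zeta> = 1" for \<zeta>
  proof -
    \<comment> \<open>The supremum ranges over r < 1 only, so the cube of size 1 is exhausted by
      smaller ones; the shift by 2 keeps the first size positive.\<close>
    define Q where "Q m = carleson_cube \<zeta> (1 - 1 / (real m + 2))" for m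
    have "incseq Q"
    proof (rule incseq_SucI)
      fix m
      have "1 / (real (Suc m) + 2) \<le> 1 / (real m + 2)" by (intro divide_left_mono) auto
      then show "Q m \<subseteq> Q (Suc m)" by (auto simp: Q_def carleson_cube_def)
    qed
    moreover have "carleson_cube \<zeta> 1 = (\<Union>m. Q m)"
    proof (intro equalityI subsetI)
      fix z assume z: "z \<in> carleson_cube \<zeta> 1"
      then have "0 < 1 - cmod (1 - herm z \<zeta>)" by (simp add: carleson_cube_def)
      then obtain m where "inverse (real (Suc m)) < 1 - cmod (1 - herm z \<zeta>)"
        using reals_Archimedean by blast
      moreover have "1 / (real m + 2) \<le> inverse (real (Suc m))" by (simp add: field_simps)
      ultimately have "cmod (1 - herm z \<zeta>) < 1 - 1 / (real m + 2)" by linarith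
      then show "z \<in> (\<Union>m. Q m)" using z by (auto simp: Q_def carleson_cube_def)
    next
      fix z assume "z \<in> (\<Union>m. Q m)"
      then obtain m where "norm z < 1" "cmod (1 - herm z \<zeta>) < 1 - 1 / (real m + 2)"
        by (auto simp: Q_def carleson_cube_def)
      moreover have "0 < 1 / (real m + 2)" by simp
      ultimately have "cmod (1 - herm z \<zeta>) < 1" by linarith
      then show "z \<in> carleson_cube \<zeta> 1" using \<open>norm z < 1\<close> by (simp add: carleson_cube_def)
    qed
    moreover have "range Q \<subseteq> sets \<mu>" by (auto simp: Q_def intro: carleson_cube_in_sets)
    ultimately have "emeasure \<mu> (carleson_cube \<zeta> 1) = (SUP m. emeasure \<mu> (Q m))"
      using SUP_emeasure_incseq[of Q \<mu>] by simp
    also have "\<dots> \<le> M"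
      unfolding Q_def by (intro SUP_least less1 \<zeta>) (auto simp: field_simps)
    finally show ?thesis .
  qed
  define I where "I = (UNIV :: 'n set) \<times> {1, -1, \<i>, -\<i>}"
  \<comment> \<open>No cube of size 1 contains the origin, which is therefore covered by its
    singleton; this is where \<open>fin\<close> enters.\<close>
  define \<C> where "\<C> = insert {0} ((\<lambda>(j, u). carleson_cube (axis j u) 1) ` I)"
  show ?thesis
  proof (rule emeasure_ball_finite_of_cover[of \<C>])
    show "finite \<C>" by (simp add: \<C>_def I_def)
    have "{0} \<in> sets \<mu>" unfolding sets_\<mu> by (auto simp: sets_restrict_space_iff)
    moreover have "emeasure \<mu> (carleson_cube (axis j u) 1) < \<infinity>" if "(j, u) \<in> I" for j u
      using cube1[of "axis j u"] that M
      by (auto simp: I_def norm_vec_def L2_set_def axis_def if_distrib[of norm] if_distrib[of "\<lambda>x. x\<^sup>2"]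
          cong: if_cong intro: le_less_trans)
    ultimately show "X \<in> sets \<mu> \<and> emeasure \<mu> X < \<infinity>" if "X \<in> \<C>" for X
      using that fin by (auto simp: \<C>_def intro: carleson_cube_in_sets)
    show "ball 0 1 \<subseteq> \<Union>\<C>"
    proof
      fix z :: "complex ^ 'n" assume "z \<in> ball 0 1"
      then have z: "norm z < 1" by simp
      show "z \<in> \<Union>\<C>"
      proof (cases "z = 0")
        case False
        then obtain j where j: "z $ j \<noteq> 0" by (auto simp: vec_eq_iff)
        have "\<exists>u\<in>{1, -1, \<i>, -\<i>}. cmod (1 - z $ j * cnj u) < 1"
          by (rule exists_unit_near) (use j z Finite_Cartesian_Product.norm_nth_le[of z j] in auto)
        then obtain u where u: "u \<in> {1, -1, \<i>, -\<i>}" "cmod (1 - z $ j * cnj u) < 1" by blast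
        have "herm z (axis j u) = z $ j * cnj u"
          by (simp add: herm_def axis_def if_distrib[of "\<lambda>x. _ * cnj x"] cong: if_cong)
        then have "z \<in> carleson_cube (axis j u) 1" using u z by (simp add: carleson_cube_def)
        moreover have "(j, u) \<in> I" using u by (simp add: I_def)
        ultimately show ?thesis by (force simp: \<C>_def)
      qed (simp add: \<C>_def)
    qed
  qed
qed

text \<open>Compactness of the closed ball: Bergman balls are neighbourhoods of the interior points,
  cubes of one fixed size take care of the sphere. The origin is inside a Bergman ball, so its mass
  is finite by \<open>D\<close>.\<close>

lemma emeasure_ball_finite_of_bergman_balls:
  assumes R: "R > 0" and "r\<^sub>0 > 0"
    and D: "\<And>a. norm a < 1 \<Longrightarrow> emeasure \<mu> (bergman_ball a R) < \<infinity>"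
    and Q: "\<And>\<zeta>. norm \<zeta> = 1 \<Longrightarrow> emeasure \<mu> (carleson_cube \<zeta> r\<^sub>0) < \<infinity>"
  shows "emeasure \<mu> (ball 0 1) < \<infinity>"
proof -
  \<comment> \<open>At a boundary point the cube is taken without its restriction to the open ball,
    so that the set is open and contains its centre.\<close>
  define V where "V x = (if norm x < 1 then bergman_ball x R else {z. cmod (1 - herm z x) < r\<^sub>0})"
    for x :: "complex ^ 'n"
  have "open (V x)" for x
    unfolding V_def using open_bergman_ball[OF R]
    by (auto intro!: open_Collect_less continuous_intros)
  moreover have "cball 0 1 \<subseteq> (\<Union>x\<in>cball 0 1. V x)"
  proof
    fix x :: "complex ^ 'n" assume x: "x \<in> cball 0 1"
    then have "x \<in> V x"
      using centre_in_bergman_ball[OF R, of x] \<open>r\<^sub>0 > 0\<close> by (auto simp: V_def herm_self)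
    with x show "x \<in> (\<Union>x\<in>cball 0 1. V x)" by blast
  qed
  ultimately obtain T where T: "T \<subseteq> cball 0 1" "finite T" "cball 0 1 \<subseteq> (\<Union>x\<in>T. V x)"
    using compactE_image[OF compact_cball] by metis
  show ?thesis
  proof (rule emeasure_ball_finite_of_cover[of "(\<lambda>x. ball 0 1 \<inter> V x) ` T"])
    show "finite ((\<lambda>x. ball 0 1 \<inter> V x) ` T)" using T by simp
    show "ball 0 1 \<subseteq> \<Union>((\<lambda>x. ball 0 1 \<inter> V x) ` T)" 
      using T(3) ball_subset_cball[of 0 1] by blast
    have "ball 0 1 \<inter> V x \<in> sets \<mu> \<and> emeasure \<mu> (ball 0 1 \<inter> V x) < \<infinity>" if "x \<in> T" for x
    proof (cases "norm x < 1")
      case True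
      then have "ball 0 1 \<inter> V x = bergman_ball x R" by (auto simp: V_def bergman_ball_def)
      then show ?thesis using bergman_ball_in_sets[OF R True] D[OF True] by simp
    next
      case False
      then have "norm x = 1" using subsetD[OF T(1) that] by simp
      moreover have "ball 0 1 \<inter> V x = carleson_cube x r\<^sub>0"
        using False by (auto simp: V_def carleson_cube_def)
      ultimately show ?thesis using carleson_cube_in_sets Q by simp
    qed
    then show "X \<in> sets \<mu> \<and> emeasure \<mu> X < \<infinity>" if "X \<in> (\<lambda>x. ball 0 1 \<inter> V x) ` T" for X
      using that by blast
  qed
qed

section \<open>Equivalence of the boundedness conditions\<close>

text \<open>The enclosing cube is admissible only if C h < 1 for the depth h of a. Otherwise C h
  \<ge> 1 keeps the denominator away from 0 and the total mass bounds the ratio.\<close>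

lemma bergman_bounded_if_carleson_bounded:
  assumes fin: "emeasure \<mu> {0} < \<infinity>" and cb: "carleson_bounded \<gamma> \<mu>" and R: "R > 0"
  shows "bergman_bounded \<gamma> \<mu> R"
proof -
  let ?N = "real CARD('n) * \<gamma>"
  define B where "B = emeasure \<mu> (ball 0 1)"
  have B: "B < \<infinity>"
    using emeasure_ball_finite_of_carleson_bounded[OF fin cb] by (simp add: B_def)
  define M where "M = (SUP (\<zeta>, r)\<in>sphere 0 1 \<times> {0<..<1}. carleson_ratio \<gamma> \<mu> \<zeta> r)"
  have M: "M < \<infinity>" using cb by (simp add: carleson_bounded_def M_def)
  define C where "C = 2 / (1 - (tanh R)\<^sup>2) + 1"
  have C: "1 \<le> C" using tanh_sq_bounds[OF R] by (simp add: C_def)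
  have "bergman_ratio \<gamma> \<mu> R a \<le> ennreal (C powr ?N) * (M + B)" if a: "norm a < 1" for a
  proof -
    define h where "h = 1 - (norm a)\<^sup>2"
    have h: "0 < h" using one_minus_norm_sq_bounds(1)[of a] a by (simp add: h_def)
    show ?thesis
    proof (cases "C * h < 1")
      case True
      then have "a \<noteq> 0" using C by (auto simp: h_def)
      then have "bergman_ratio \<gamma> \<mu> R a \<le> ennreal (C powr ?N) *
          carleson_ratio \<gamma> \<mu> ((1 / norm a) *\<^sub>R a) (C * h)"
        using bergman_ratio_le_carleson_ratio[OF R a] by (simp add: C_def h_def)
      also have "carleson_ratio \<gamma> \<mu> ((1 / norm a) *\<^sub>R a) (C * h) \<le> M"
        unfolding M_def using True \<open>a \<noteq> 0\<close> C h
        by (intro SUP_upper2[of "((1 / norm a) *\<^sub>R a, C * h)"]) auto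
      also have "M \<le> M + B" by simp
      finally show ?thesis by (simp add: mult_left_mono)
    next
      case False
      have "emeasure \<mu> (bergman_ball a R) \<le> B * 1"
        unfolding B_def
        by (auto intro!: emeasure_mono simp: bergman_ball_def simp flip: space_eq_ball)
      also have "\<dots> \<le> (M + B) * ennreal ((C * h) powr ?N)"
        using False \<gamma> by (intro mult_mono) (auto simp: ge_one_powr_ge_zero)
      also have "ennreal ((C * h) powr ?N) = ennreal (C powr ?N) * ennreal (h powr ?N)"
        using C h by (simp add: powr_mult ennreal_mult)
      finally show ?thesis using a by (simp add: bergman_ratio_le_iff h_def mult_ac)
    qed
  qed
  then have "(SUP a\<in>ball 0 1. bergman_ratio \<gamma> \<mu> R a) \<le> ennreal (C powr ?N) * (M + B)"
    by (intro SUP_least) simp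
  also have "\<dots> < \<infinity>" using M B by (simp add: ennreal_mult_less_top)
  finally show ?thesis by (simp add: bergman_bounded_def)
qed

text \<open>The layer estimate reaches only r \<le> \<open>r\<^sub>0\<close>. For larger r the
  factor (r / \<open>r\<^sub>0\<close>) powr (n\<gamma>) is at least 1, and the total mass
  suffices.\<close>

lemma carleson_bounded_if_bergman_bounded:
  assumes R: "R > 0" and bb: "bergman_bounded \<gamma> \<mu> R"
  shows "carleson_bounded \<gamma> \<mu>"
proof -
  let ?N = "real CARD('n) * \<gamma>"
  define M where "M = (SUP a\<in>ball 0 1. bergman_ratio \<gamma> \<mu> R a)"
  have M: "M < \<infinity>" using bb by (simp add: bergman_bounded_def M_def)
  have ratio: "bergman_ratio \<gamma> \<mu> R a \<le> M" if "norm a < 1" for a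
    unfolding M_def using that by (intro SUP_upper) simp
  obtain C r\<^sub>0 where C: "C > 0" and r0: "r\<^sub>0 > 0"
    and main: "\<And>\<zeta> r M. norm \<zeta> = 1 \<Longrightarrow> 0 < r \<Longrightarrow> r \<le> r\<^sub>0 \<Longrightarrow>
    (\<forall>a. norm a < 1 \<longrightarrow> 1 - (norm a)\<^sup>2 < 2 * r \<longrightarrow> bergman_ratio \<gamma> \<mu> R a \<le> M) \<Longrightarrow>
    carleson_ratio \<gamma> \<mu> \<zeta> r \<le> ennreal C * M"
    using carleson_ratio_le_of_bergman_ratio_le[OF R] by metis
  have small: "carleson_ratio \<gamma> \<mu> \<zeta> r \<le> ennreal C * M" if "norm \<zeta> = 1" "0 < r" "r \<le> r\<^sub>0" for \<zeta> r
    using main[OF that] ratio by blast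
  define B where "B = emeasure \<mu> (ball 0 1)"
  have B: "B < \<infinity>"
    unfolding B_def
  proof (rule emeasure_ball_finite_of_bergman_balls[OF R r0])
    fix a :: "complex ^ 'n" assume a: "norm a < 1"
    then have "emeasure \<mu> (bergman_ball a R) \<le> M * ennreal ((1 - (norm a)\<^sup>2) powr ?N)"
      using ratio bergman_ratio_le_iff by blast
    also have "\<dots> < \<infinity>" using M by (simp add: ennreal_mult_less_top)
    finally show "emeasure \<mu> (bergman_ball a R) < \<infinity>" .
  next
    fix \<zeta> :: "complex ^ 'n" assume "norm \<zeta> = 1"
    then have "emeasure \<mu> (carleson_cube \<zeta> r\<^sub>0) \<le> ennreal C * M * ennreal (r\<^sub>0 powr ?N)"
      using small r0 carleson_ratio_le_iff by blast
    also have "\<dots> < \<infinity>" using M by (simp add: ennreal_mult_less_top)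
    finally show "emeasure \<mu> (carleson_cube \<zeta> r\<^sub>0) < \<infinity>" .
  qed
  have "carleson_ratio \<gamma> \<mu> \<zeta> r \<le> ennreal C * M + B * ennreal ((1 / r\<^sub>0) powr ?N)"
    if \<zeta>: "norm \<zeta> = 1" and r: "0 < r" for \<zeta> r
  proof (cases "r \<le> r\<^sub>0")
    case True
    then show ?thesis using small[OF \<zeta> r] by (meson add_increasing2 zero_le)
  next
    case False
    have "emeasure \<mu> (carleson_cube \<zeta> r) \<le> B * 1"
      unfolding B_def by (auto intro!: emeasure_mono simp: carleson_cube_def simp flip: space_eq_ball)
    also have "\<dots> \<le> B * ennreal ((1 / r\<^sub>0 * r) powr ?N)"
      using False r0 \<gamma> by (intro mult_left_mono) (auto simp: ge_one_powr_ge_zero)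
    also have "ennreal ((1 / r\<^sub>0 * r) powr ?N) = ennreal ((1 / r\<^sub>0) powr ?N) * ennreal (r powr ?N)"
      using r r0 by (subst powr_mult) (auto simp: ennreal_mult)
    finally have "carleson_ratio \<gamma> \<mu> \<zeta> r \<le> B * ennreal ((1 / r\<^sub>0) powr ?N)"
      using r by (simp add: carleson_ratio_le_iff mult_ac)
    then show ?thesis by (meson add_increasing zero_le)
  qed
  then have "(SUP (\<zeta>, r)\<in>sphere 0 1 \<times> {0<..<1}. carleson_ratio \<gamma> \<mu> \<zeta> r)
      \<le> ennreal C * M + B * ennreal ((1 / r\<^sub>0) powr ?N)"
    by (intro SUP_least) auto
  also have "\<dots> < \<infinity>" using M B by (simp add: ennreal_mult_less_top)
  finally show ?thesis by (simp add: carleson_bounded_def)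
qed

section \<open>Equivalence of the vanishing conditions\<close>

lemma bergman_vanishing_if_carleson_vanishing:
  assumes cv: "carleson_vanishing \<gamma> \<mu>" and R: "R > 0"
  shows "bergman_vanishing \<gamma> \<mu> R"
  unfolding bergman_vanishing_def
proof (rule order_tendstoI)
  fix l :: ennreal assume "0 < l"
  then obtain \<epsilon> where \<epsilon>: "0 < \<epsilon>" "ennreal \<epsilon> \<le> l"
    by (cases l) (auto intro: that[of 1])
  let ?N = "real CARD('n) * \<gamma>"
  define C where "C = 2 / (1 - (tanh R)\<^sup>2) + 1"
  have C: "1 \<le> C" using tanh_sq_bounds[OF R] by (simp add: C_def)
  have "\<forall>\<^sub>F r in at_right 0. \<forall>\<zeta>\<in>sphere 0 1. carleson_ratio \<gamma> \<mu> \<zeta> r < ennreal (\<epsilon> / C powr ?N)"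
    using cv \<epsilon> C by (simp add: carleson_vanishing_def)
  then obtain b where b: "b > 0"
    "\<And>r \<zeta>. 0 < r \<Longrightarrow> r < b \<Longrightarrow> norm \<zeta> = 1 \<Longrightarrow> carleson_ratio \<gamma> \<mu> \<zeta> r < ennreal (\<epsilon> / C powr ?N)"
    unfolding eventually_at_right_field by auto
  \<comment> \<open>For |a| > c the depth is at most 2 (1 - |a|) < b / C, so the enclosing cube has
    size below b. The maximum with 0 forces a \<noteq> 0, as the direction a/|a| requires.\<close>
  define c where "c = max 0 (1 - b / (2 * C))"
  have "bergman_ratio \<gamma> \<mu> R a < l" if a: "c < norm a" "norm a < 1" for a
  proof -
    define h where "h = 1 - (norm a)\<^sup>2"
    have h: "0 < h" using one_minus_norm_sq_bounds(1)[of a] a by (simp add: h_def)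
    have "h \<le> 2 * (1 - norm a)" unfolding h_def by (rule one_minus_norm_sq_bounds)
    also have "\<dots> < b / C" using a by (simp add: c_def)
    finally have Ch: "C * h < b" using C by (simp add: field_simps)
    have "a \<noteq> 0" using a by (auto simp: c_def)
    then have "bergman_ratio \<gamma> \<mu> R a \<le> ennreal (C powr ?N) *
        carleson_ratio \<gamma> \<mu> ((1 / norm a) *\<^sub>R a) (C * h)"
      using bergman_ratio_le_carleson_ratio[OF R a(2)] by (simp add: C_def h_def)
    also have "\<dots> < ennreal (C powr ?N) * ennreal (\<epsilon> / C powr ?N)"
      using b(2)[of "C * h" "(1 / norm a) *\<^sub>R a"] Ch C h \<open>a \<noteq> 0\<close>
      by (intro ennreal_mult_strict_left_mono) auto
    also have "\<dots> = ennreal \<epsilon>" using C \<epsilon> by (simp flip: ennreal_mult)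
    finally show ?thesis using \<epsilon> by simp
  qed
  moreover have "c < 1" using b C by (simp add: c_def)
  ultimately show "\<forall>\<^sub>F a in filtercomap norm (at_left 1). bergman_ratio \<gamma> \<mu> R a < l"
    unfolding eventually_filtercomap eventually_at_left_field
    by (intro exI[of _ "\<lambda>y. c < y \<and> y < 1"]) auto
qed simp

lemma carleson_vanishing_if_bergman_vanishing:
  assumes R: "R > 0" and bv: "bergman_vanishing \<gamma> \<mu> R"
  shows "carleson_vanishing \<gamma> \<mu>"
  unfolding carleson_vanishing_def
proof (intro allI impI)
  fix \<epsilon> :: real assume \<epsilon>: "0 < \<epsilon>"
  obtain C r\<^sub>0 where C: "C > 0" and r0: "r\<^sub>0 > 0"
    and main: "\<And>\<zeta> r M. norm \<zeta> = 1 \<Longrightarrow> 0 < r \<Longrightarrow> r \<le> r\<^sub>0 \<Longrightarrow>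
    (\<forall>a. norm a < 1 \<longrightarrow> 1 - (norm a)\<^sup>2 < 2 * r \<longrightarrow> bergman_ratio \<gamma> \<mu> R a \<le> M) \<Longrightarrow>
    carleson_ratio \<gamma> \<mu> \<zeta> r \<le> ennreal C * M"
    using carleson_ratio_le_of_bergman_ratio_le[OF R] by metis
  have "\<forall>\<^sub>F a in filtercomap norm (at_left 1). bergman_ratio \<gamma> \<mu> R a < ennreal (\<epsilon> / (2 * C))"
    using bv \<epsilon> C unfolding bergman_vanishing_def by (intro order_tendstoD(2)) auto
  then obtain c where c: "c < 1"
    "\<And>a. c < norm a \<Longrightarrow> norm a < 1 \<Longrightarrow> bergman_ratio \<gamma> \<mu> R a < ennreal (\<epsilon> / (2 * C))"
    unfolding eventually_filtercomap eventually_at_left_field by blast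
  \<comment> \<open>With r < (1 - c)/2, depth below 2 r gives 1 - |a| < 1 - c, that is |a| > c. The
    factor 2 in \<epsilon> / (2 C) makes the final inequality strict.\<close>
  have "carleson_ratio \<gamma> \<mu> \<zeta> r < ennreal \<epsilon>"
    if \<zeta>: "norm \<zeta> = 1" and r: "0 < r" "r < min r\<^sub>0 ((1 - c) / 2)" for r \<zeta>
  proof -
    have "carleson_ratio \<gamma> \<mu> \<zeta> r \<le> ennreal C * ennreal (\<epsilon> / (2 * C))"
    proof (rule main[OF \<zeta> r(1)])
      show "r \<le> r\<^sub>0" using r by simp
      show "\<forall>a. norm a < 1 \<longrightarrow> 1 - (norm a)\<^sup>2 < 2 * r \<longrightarrow> bergman_ratio \<gamma> \<mu> R a \<le> ennreal (\<epsilon> / (2 * C))"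
      proof (intro allI impI)
        fix a :: "complex ^ 'n" assume a: "norm a < 1" "1 - (norm a)\<^sup>2 < 2 * r"
        then have "c < norm a" using one_minus_norm_sq_bounds(2)[of a] r by simp
        then show "bergman_ratio \<gamma> \<mu> R a \<le> ennreal (\<epsilon> / (2 * C))" using c(2) a less_imp_le by blast
      qed
    qed
    also have "\<dots> = ennreal (\<epsilon> / 2)" using C \<epsilon> by (simp flip: ennreal_mult)
    also have "\<dots> < ennreal \<epsilon>" using \<epsilon> by (simp add: ennreal_less_iff)
    finally show ?thesis .
  qed
  moreover have "0 < min r\<^sub>0 ((1 - c) / 2)" using r0 c by simp
  ultimately show "\<forall>\<^sub>F r in at_right 0. \<forall>\<zeta>\<in>sphere 0 1. carleson_ratio \<gamma> \<mu> \<zeta> r < ennreal \<epsilon>"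
    unfolding eventually_at_right_field by (metis mem_sphere_0)
qed

end

theorem proposition2p3:
  fixes \<gamma> :: real and \<mu> :: "(complex ^ 'n) measure"
  assumes "\<gamma> > 1"
    and "sets \<mu> = sets (restrict_space borel (ball 0 1))"
  shows "(emeasure \<mu> {0} < \<infinity> \<longrightarrow>
        ((\<exists>R>0. bergman_bounded \<gamma> \<mu> R) \<longleftrightarrow> carleson_bounded \<gamma> \<mu>) \<and>
        ((\<forall>R>0. bergman_bounded \<gamma> \<mu> R) \<longleftrightarrow> carleson_bounded \<gamma> \<mu>)) \<and>
      ((\<exists>R>0. bergman_vanishing \<gamma> \<mu> R) \<longleftrightarrow> carleson_vanishing \<gamma> \<mu>) \<and>
      ((\<forall>R>0. bergman_vanishing \<gamma> \<mu> R) \<longleftrightarrow> carleson_vanishing \<gamma> \<mu>)"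
  \<comment> \<open>Each Bergman condition for one R gives the Carleson condition, which returns it
    for every R; so independence of R results from passing through the cubes. The fact 0 < 1
    supplies a radius for going from all R to some R.\<close>
  using bergman_bounded_if_carleson_bounded[OF assms] carleson_bounded_if_bergman_bounded[OF assms]
    bergman_vanishing_if_carleson_vanishing[OF assms] carleson_vanishing_if_bergman_vanishing[OF assms]
    zero_less_one[where 'a = real]
  by blast

end
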